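(* (1) The formula $ADBDCDAD.DADCDBDA$ is avoided by $b_4$. (2) The formula $ABCDADC.CDADCBA$ is avoided by $z_3$. (3) The formula $ABACDBAC.CABDCABA$ is avoided by $z_3$ and by $b_4$.
   Context: A formula is a finite set of non-empty words over variables (fragments), written separated by dots. An occurrence of a formula $f$ in a word $w$ is a non-erasing morphism $h$ from variables to non-empty words such that $h(\phi)$ is a factor of $w$ for every fragment $\phi$; $w$ avoids $f$ if it has no occurrence. $b_4$ is the fixed point starting with $0$ of the morphism $0\mapsto 01,\ 1\mapsto 03,\ 2\mapsto 21,\ 3\mapsto 23$; $z_3$ is the fixed point starting with $0$ of the morphism $0\mapsto 01,\ 1\mapsto 2,\ 2\mapsto 20$. *)

theory Defs
  imports Complex_Main "HOL-Library.Omega_Words_Fun"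
begin

definition morph :: "('a \<Rightarrow> 'b list) \<Rightarrow> 'a list \<Rightarrow> 'b list" where
  "morph h u = concat (map h u)"

definition nonerasing :: "('a \<Rightarrow> 'b list) \<Rightarrow> bool" where
  "nonerasing h \<longleftrightarrow> (\<forall>x. h x \<noteq> [])"

text \<open>Infinite words are functions on the natural numbers, and \<open>w [i \<rightarrow> j]\<close> is the factor
  of \<open>w\<close> at the positions \<open>i, \<dots>, j - 1\<close>.\<close>

definition is_factor :: "'a list \<Rightarrow> 'a word \<Rightarrow> bool" where
  "is_factor u w \<longleftrightarrow> (\<exists>i j. u = w [i \<rightarrow> j])"

text \<open>\<open>v = h(w)\<close> for infinite words: the image of every prefix of \<open>w\<close> is a prefix of \<open>v\<close>.
  For a non-erasing \<open>h\<close> this determines \<open>v\<close>.\<close>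

definition is_morph_image :: "('a \<Rightarrow> 'b list) \<Rightarrow> 'a word \<Rightarrow> 'b word \<Rightarrow> bool" where
  "is_morph_image h w v \<longleftrightarrow>
    (\<forall>n. morph h (w [0 \<rightarrow> n]) = v [0 \<rightarrow> length (morph h (w [0 \<rightarrow> n]))])"

definition fixed_point_from :: "('a \<Rightarrow> 'a list) \<Rightarrow> 'a \<Rightarrow> 'a word" where
  "fixed_point_from h a = (THE w. is_morph_image h w w \<and> w 0 = a)"

lemma length_morph_ge:
  assumes "nonerasing h"
  shows "length u \<le> length (morph h u)"
proof (induction u)
  case (Cons x u)
  have "length (h x) > 0" using assms by (simp add: nonerasing_def)
  with Cons show ?case by (simp add: morph_def del: length_greater_0_conv)
qed (simp add: morph_def)

lemma morph_append: "morph h (u @ v) = morph h u @ morph h v"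
  by (simp add: morph_def)

theorem fixed_point_ex1:
  assumes ne: "nonerasing h" and ha: "h a = a # u" and u: "u \<noteq> []"
  shows "\<exists>!w. is_morph_image h w w \<and> w 0 = a"
proof (rule ex_ex1I)
  define P where "P k = (morph h ^^ k) [a]" for k
  have P_step: "\<exists>t. t \<noteq> [] \<and> P (Suc k) = P k @ t" for k
  proof (induction k)
    case 0
    show ?case using ha u by (auto simp: P_def morph_def)
  next
    case (Suc k)
    then obtain t where t: "t \<noteq> []" "P (Suc k) = P k @ t" by blast
    have "P (Suc (Suc k)) = morph h (P (Suc k))" by (simp add: P_def)
    also have "\<dots> = P (Suc k) @ morph h t"
      unfolding t(2) morph_append using t(2) by (simp add: P_def)
    finally have "P (Suc (Suc k)) = P (Suc k) @ morph h t" .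
    moreover have "morph h t \<noteq> []"
      using length_morph_ge[OF ne, of t] t(1) by auto
    ultimately show ?case by blast
  qed
  have P_len: "k < length (P k)" for k
  proof (induction k)
    case 0
    show ?case by (simp add: P_def)
  next
    case (Suc k)
    obtain t where "t \<noteq> []" "P (Suc k) = P k @ t" using P_step by blast
    then have "length (P k) < length (P (Suc k))" by simp
    with Suc show ?case by linarith
  qed
  have P_add: "\<exists>t. P (k + d) = P k @ t" for k d
  proof (induction d)
    case (Suc d)
    then obtain t where "P (k + d) = P k @ t" by blast
    moreover obtain s where "P (Suc (k + d)) = P (k + d) @ s" using P_step by blast
    ultimately show ?case by simp
  qed simp
  define w where "w n = P n ! n" for n
  have P_nth: "P k ! i = w i" if "i < length (P k)" for i k
  proof (cases "k \<le> i")
    case True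
    then obtain t where "P i = P k @ t" using P_add[of k "i - k"] by auto
    with that show ?thesis by (simp add: w_def nth_append)
  next
    case False
    then obtain t where "P k = P i @ t" using P_add[of i "k - i"] by auto
    with P_len[of i] show ?thesis by (simp add: w_def nth_append)
  qed
  have pre: "x = w [0 \<rightarrow> length x]" if "P k = x @ y" for x y k
  proof (rule nth_equalityI)
    fix i assume i: "i < length x"
    then have "P k ! i = w i" using that by (intro P_nth) simp
    with that i show "x ! i = (w [0 \<rightarrow> length x]) ! i"
      by (simp add: nth_append subsequence_def)
  qed (simp add: subsequence_def)
  have "morph h (w [0 \<rightarrow> n]) = w [0 \<rightarrow> length (morph h (w [0 \<rightarrow> n]))]" for n
  proof -
    have "P n = take n (P n) @ drop n (P n)" by simp
    moreover from pre[OF this] have "take n (P n) = w [0 \<rightarrow> n]"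
      using P_len[of n] by (simp add: min_def split: if_splits)
    ultimately have "P n = w [0 \<rightarrow> n] @ drop n (P n)" by metis
    then have "P (Suc n) = morph h (w [0 \<rightarrow> n]) @ morph h (drop n (P n))"
      by (metis P_def funpow.simps(2) comp_apply morph_append)
    then show ?thesis by (rule pre)
  qed
  moreover have "w 0 = a" by (simp add: w_def P_def)
  ultimately show "\<exists>w. is_morph_image h w w \<and> w 0 = a"
    unfolding is_morph_image_def by blast
next
  fix w v
  assume w: "is_morph_image h w w \<and> w 0 = a" and v: "is_morph_image h v v \<and> v 0 = a"
  have eq: "w [0 \<rightarrow> Suc n] = v [0 \<rightarrow> Suc n]" for n
  proof (induction n)
    case 0
    show ?case using w v by (simp add: subsequence_def)
  next
    case (Suc n)
    let ?m = "morph h (w [0 \<rightarrow> Suc n])"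
    have "w [0 \<rightarrow> Suc n] = a # map w [1..<Suc n]"
      using w by (simp add: subsequence_def upt_conv_Cons del: upt_Suc)
    then have "?m = a # u @ morph h (map w [1..<Suc n])"
      using ha by (simp add: morph_def del: upt_Suc)
    moreover have "n \<le> length (morph h (map w [1..<Suc n]))"
      using length_morph_ge[OF ne, of "map w [1..<Suc n]"] by (simp del: upt_Suc)
    moreover have "length u > 0" using u by simp
    ultimately have len: "Suc (Suc n) \<le> length ?m"
      by (simp del: upt_Suc length_greater_0_conv)
    have "w [0 \<rightarrow> length ?m] = v [0 \<rightarrow> length ?m]"
      using w v Suc unfolding is_morph_image_def by metis
    then have "take (Suc (Suc n)) (w [0 \<rightarrow> length ?m]) = take (Suc (Suc n)) (v [0 \<rightarrow> length ?m])"
      by simp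
    with len show ?case by (simp add: subsequence_def take_map del: upt_Suc)
  qed
  show "w = v"
  proof
    fix n
    show "w n = v n" using arg_cong[OF eq, of last n] by (simp add: subsequence_def)
  qed
qed


datatype letter4 = L0 | L1 | L2 | L3

fun b4_morph :: "letter4 \<Rightarrow> letter4 list" where
  "b4_morph L0 = [L0, L1]"
| "b4_morph L1 = [L0, L3]"
| "b4_morph L2 = [L2, L1]"
| "b4_morph L3 = [L2, L3]"

definition b4 :: "letter4 word" where
  "b4 = fixed_point_from b4_morph L0"

datatype letter3 = K0 | K1 | K2

fun z3_morph :: "letter3 \<Rightarrow> letter3 list" where
  "z3_morph K0 = [K0, K1]"
| "z3_morph K1 = [K2]"
| "z3_morph K2 = [K2, K0]"

definition z3 :: "letter3 word" where
  "z3 = fixed_point_from z3_morph K0"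

lemma b4_fixed_point: "is_morph_image b4_morph b4 b4 \<and> b4 0 = L0"
proof -
  have "b4_morph x \<noteq> []" for x by (cases x) auto
  then have "\<exists>!w. is_morph_image b4_morph w w \<and> w 0 = L0"
    by (intro fixed_point_ex1[where u = "[L1]"]) (auto simp: nonerasing_def)
  from theI'[OF this] show ?thesis by (simp add: b4_def fixed_point_from_def)
qed

lemma z3_fixed_point: "is_morph_image z3_morph z3 z3 \<and> z3 0 = K0"
proof -
  have "z3_morph x \<noteq> []" for x by (cases x) auto
  then have "\<exists>!w. is_morph_image z3_morph w w \<and> w 0 = K0"
    by (intro fixed_point_ex1[where u = "[K1]"]) (auto simp: nonerasing_def)
  from theI'[OF this] show ?thesis by (simp add: z3_def fixed_point_from_def)
qed


text \<open>A formula is given by its set of fragments.\<close>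

type_synonym 'v formula = "'v list set"

definition occurrence :: "('v \<Rightarrow> 'a list) \<Rightarrow> 'v formula \<Rightarrow> 'a word \<Rightarrow> bool" where
  "occurrence h f w \<longleftrightarrow> nonerasing h \<and> (\<forall>\<phi>\<in>f. is_factor (morph h \<phi>) w)"

definition avoids :: "'a word \<Rightarrow> 'v formula \<Rightarrow> bool" where
  "avoids w f \<longleftrightarrow> (\<nexists>h. occurrence h f w)"

datatype var = A | B | C | D

end

theory Submission
  imports Defs
begin

text \<open>In \<open>b\<^sub>4\<close> the letter at a position \<open>p = 2\<^sup>k (2 m + 1)\<close> is determined by the parity of
  \<open>p\<close> and the parity of \<open>m\<close>. Hence, if two occurrences of a factor are congruent modulo
  \<open>2\<^sup>v\<close> and the factor covers an odd multiple of \<open>2\<^bsup>v-1\<^esup>\<close>, they are congruent modulo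
  \<open>2\<^bsup>v+1\<^esup>\<close>. For both formulas this forces the distance of two occurrences of a variable to be
  divisible by every power of \<open>2\<close>.

  The morphism of \<open>z\<^sub>3\<close> is the square of \<open>\<theta>: 0 \<mapsto> 2, 1 \<mapsto> 0, 2 \<mapsto> 01\<close>, and every factor of
  \<open>z\<^sub>3\<close> or \<open>\<theta>(z\<^sub>3)\<close> is desubstituted uniquely, since \<open>1\<close> only occurs after \<open>0\<close>. An
  occurrence of a pattern (fragments over variables and letters) therefore yields an occurrence of
  one of finitely many desubstituted patterns at smaller positions. An executable search, proved
  sound, shows that each of these contains an instance of the original pattern or of a pattern
  excluded before, so that an infinite descent results.\<close>

section \<open>The word \<open>b\<^sub>4\<close>\<close>

text \<open>A letter of \<open>b4\<close> carries two bits, the parity of its position and the value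
  \<open>hi\<close> there, and \<open>hi\<close> is the regular paperfolding sequence. The obstacle
  is that a variable may be too short to cover the decisive odd multiple; then its neighbours must
  cover it, and the congruences already known force them to be long enough. For ABACDBAC.CABDCABA
  one case resists this: there the images of A and D turn out to be equal and a square appears,
  whereas \<open>b4\<close> is square-free. For \<open>z3\<close> the obstacle is that images of
  variables need not begin or end at block borders of \<open>theta\<close>. Cutting off an initial 1
  (the second letter of a block 01) and a final 0 (possibly the first letter of such a block) leaves
  an image under \<open>theta\<close>, possibly empty; this gives seven shapes per variable.
  Occurrences are measured by their ends, not their starts: a start at 0 would stay at 0, while
  every end from 4 on moves strictly to the left.\<close>

definition occ_at :: "'a word \<Rightarrow> nat \<Rightarrow> 'a list \<Rightarrow> bool" where
  "occ_at w x u \<longleftrightarrow> (\<forall>j<length u. w (x + j) = u ! j)"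

lemma occ_at_append [simp]: "occ_at w x (u @ v) \<longleftrightarrow> occ_at w x u \<and> occ_at w (x + length u) v"
proof
  assume a: "occ_at w x (u @ v)"
  have "w (x + length u + j) = v ! j" if "j < length v" for j
    using a[unfolded occ_at_def, rule_format, of "length u + j"] that by (simp add: add.assoc)
  moreover have "w (x + j) = u ! j" if "j < length u" for j
    using a[unfolded occ_at_def, rule_format, of j] that by (simp add: nth_append)
  ultimately show "occ_at w x u \<and> occ_at w (x + length u) v" by (simp add: occ_at_def)
next
  assume a: "occ_at w x u \<and> occ_at w (x + length u) v"
  show "occ_at w x (u @ v)"
    unfolding occ_at_def
  proof (intro allI impI)
    fix j assume j: "j < length (u @ v)"
    show "w (x + j) = (u @ v) ! j"
    proof (cases "j < length u")
      case True
      then show ?thesis using a by (simp add: occ_at_def nth_append)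
    next
      case False
      then show ?thesis using a j by (auto simp: occ_at_def nth_append dest: spec[of _ "j - length u"])
    qed
  qed
qed

lemma is_factor_occ_at: "is_factor u w \<Longrightarrow> \<exists>x. occ_at w x u"
  by (auto simp: is_factor_def occ_at_def)

lemma occ_at_eq: "occ_at w x u \<Longrightarrow> occ_at w y u \<Longrightarrow> j < length u \<Longrightarrow> w (x + j) = w (y + j)"
  by (simp add: occ_at_def)

section \<open>The letters of \<open>b4\<close> in terms of the binary expansion of the
  position\<close>

lemma b4_double: "b4 (2 * n) = b4_morph (b4 n) ! 0" "b4 (2 * n + 1) = b4_morph (b4 n) ! 1"
proof -
  have l: "length (b4_morph c) = 2" for c by (cases c) auto
  have len: "length (morph b4_morph x) = 2 * length x" for x
    by (induction x) (simp_all add: morph_def l)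
  have im: "morph b4_morph (b4 [0 \<rightarrow> m]) = b4 [0 \<rightarrow> 2 * m]" for m
  proof -
    have "morph b4_morph (b4 [0 \<rightarrow> m]) = b4 [0 \<rightarrow> length (morph b4_morph (b4 [0 \<rightarrow> m]))]"
      using b4_fixed_point unfolding is_morph_image_def by blast
    then show ?thesis by (simp only: len subsequence_length minus_nat.diff_0)
  qed
  have "b4 [0 \<rightarrow> 2 * Suc n] = b4 [0 \<rightarrow> 2 * n] @ b4_morph (b4 n)"
    using im[of "Suc n"] im[of n] by (simp add: morph_append morph_def)
  then have "[b4 (2 * n), b4 (2 * n + 1)] = b4_morph (b4 n)" by simp
  then show "b4 (2 * n) = b4_morph (b4 n) ! 0" "b4 (2 * n + 1) = b4_morph (b4 n) ! 1"
    by (metis nth_Cons_0, metis One_nat_def nth_Cons_0 nth_Cons_Suc)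
qed

text \<open>The upper bit of the letter; the lower bit is the parity of the position. By the
  doubling rules below, \<open>hi n\<close> is the parity of m when n = 2^k(2m + 1).\<close>

definition hi :: "nat \<Rightarrow> bool" where
  "hi n \<longleftrightarrow> b4 n \<in> {L2, L3}"

lemma b4_even_iff: "b4 n \<in> {L0, L2} \<longleftrightarrow> even n"
proof (cases "even n")
  case True
  then obtain m where "n = 2 * m" by blast
  then show ?thesis using b4_double(1)[of m] by (cases "b4 m") auto
next
  case False
  then obtain m where "n = 2 * m + 1" by (elim oddE)
  then show ?thesis using b4_double(2)[of m] by (cases "b4 m") auto
qed

lemma hi_double [simp]: "hi (2 * n) = hi n"
  using b4_double(1)[of n] by (cases "b4 n") (auto simp: hi_def)

lemma hi_Suc_double [simp]: "hi (Suc (2 * n)) = odd n"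
  using b4_double(2)[of n] b4_even_iff[of n] by (cases "b4 n") (auto simp: hi_def)

lemma b4_eq_iff: "b4 p = b4 q \<longleftrightarrow> (even p \<longleftrightarrow> even q) \<and> (hi p \<longleftrightarrow> hi q)"
  using b4_even_iff[of p] b4_even_iff[of q] unfolding hi_def by (cases "b4 p"; cases "b4 q") auto

lemma mod_double: "(2 * p) mod (2 * m) = 2 * (p mod m)" for p m :: nat
  by (rule mod_mult_mult1)

lemma Suc_mod_double: "Suc (2 * p) mod (2 * m) = Suc (2 * (p mod m))" if "m > 0" for p m :: nat
proof -
  define q r where "q = p div m" and "r = p mod m"
  have p: "p = m * q + r" by (simp add: q_def r_def)
  have 1: "Suc (2 * p) = Suc (2 * r) + 2 * m * q" by (simp add: p algebra_simps)
  have "r < m" using that by (simp add: r_def)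
  then have "Suc (2 * r) < 2 * m" by linarith
  then have "Suc (2 * p) mod (2 * m) = Suc (2 * r)" unfolding 1 by (simp only: mod_mult_self2 mod_less)
  then show ?thesis by (simp only: r_def)
qed

text \<open>Both positions have the form 2^v(2m + 1), where \<open>hi\<close> is the parity of m,
  that is, the next binary digit. The induction halves the positions until they are odd.\<close>

lemma hi_half:
  "hi p = hi q \<Longrightarrow> p mod 2 ^ Suc v = 2 ^ v \<Longrightarrow> q mod 2 ^ Suc v = 2 ^ v \<Longrightarrow>
    p mod 2 ^ Suc (Suc v) = q mod 2 ^ Suc (Suc v)"
proof (induction v arbitrary: p q)
  case 0
  then have "p mod 2 = 1" "q mod 2 = 1" by simp_all
  then have "odd p" "odd q" by presburger+
  then obtain m n where "p = Suc (2 * m)" "q = Suc (2 * n)" by (metis oddE Suc_eq_plus1)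
  moreover then have "m mod 2 = n mod 2" using 0(1) by (simp add: odd_iff_mod_2_eq_one) presburger
  ultimately show ?case using Suc_mod_double[of 2 m] Suc_mod_double[of 2 n] by simp
next
  case (Suc v)
  have "even p" "even q"
    using Suc.prems(2,3) by (metis dvd_mod_iff dvd_triv_left even_mult_iff power_Suc)+
  then obtain m n where mn: "p = 2 * m" "q = 2 * n" by blast
  have "m mod 2 ^ Suc v = 2 ^ v" "n mod 2 ^ Suc v = 2 ^ v"
    using Suc.prems(2,3) mod_double[of m "2 ^ Suc v"] mod_double[of n "2 ^ Suc v"] mn by simp_all
  then have "m mod 2 ^ Suc (Suc v) = n mod 2 ^ Suc (Suc v)"
    using Suc.IH[of m n] Suc.prems(1) mn by simp
  then show ?case using mod_double[of m "2 ^ Suc (Suc v)"] mod_double[of n "2 ^ Suc (Suc v)"] mn by simp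
qed

text \<open>If 2^k is the exact power of two in p, then k \<le> v, and \<open>hi p\<close> depends
  only on p modulo 2^(k+2), a divisor of the given modulus.\<close>

lemma hi_periodic:
  "p mod 2 ^ Suc (Suc v) = q mod 2 ^ Suc (Suc v) \<Longrightarrow> p mod 2 ^ Suc v \<noteq> 0 \<Longrightarrow> hi p = hi q"
proof (induction v arbitrary: p q)
  case 0
  then have pq: "p mod 4 = q mod 4" "p mod 2 \<noteq> 0" by simp_all
  then have "odd p" "odd q" by presburger+
  then obtain m n where "p = Suc (2 * m)" "q = Suc (2 * n)" by (metis oddE Suc_eq_plus1)
  then show ?case using pq(1) by simp presburger
next
  case (Suc v)
  have ev: "even p = even q"
    using Suc.prems(1) by (metis dvd_mod_iff dvd_triv_left power_Suc)
  show ?case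
  proof (cases "even p")
    case True
    then obtain m n where mn: "p = 2 * m" "q = 2 * n" using ev by blast
    then show ?thesis using Suc.IH[of m n] Suc.prems mod_double[of m "2 ^ Suc (Suc v)"]
      mod_double[of n "2 ^ Suc (Suc v)"] mod_double[of m "2 ^ Suc v"] by simp
  next
    case False
    then obtain m n where mn: "p = Suc (2 * m)" "q = Suc (2 * n)" using ev by (metis oddE Suc_eq_plus1)
    then have "m mod 2 ^ Suc (Suc v) = n mod 2 ^ Suc (Suc v)"
      using Suc.prems(1) Suc_mod_double[of "2 ^ Suc (Suc v)" m] Suc_mod_double[of "2 ^ Suc (Suc v)" n] by simp
    then have "even m = even n" by (metis dvd_mod_iff dvd_triv_left power_Suc)
    then show ?thesis using mn by simp
  qed
qed

section \<open>Congruences modulo powers of two between positions of equal factors\<close>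

definition eqv :: "nat \<Rightarrow> int \<Rightarrow> int \<Rightarrow> bool" where
  "eqv v x y \<longleftrightarrow> 2 ^ v dvd x - y"

lemma eqv_nat: "eqv v (int p) (int q) \<longleftrightarrow> p mod 2 ^ v = q mod 2 ^ v"
proof -
  have "eqv v (int p) (int q) \<longleftrightarrow> int p mod int (2 ^ v) = int q mod int (2 ^ v)"
    by (simp add: eqv_def mod_eq_dvd_iff)
  then show ?thesis by (metis of_nat_eq_iff zmod_int)
qed

lemma eqv_lin:
  assumes "eqv v x y" "eqv v z t"
  shows "eqv v (x + z) (y + t)" "eqv v (x - z) (y - t)"
  using dvd_add[OF assms[unfolded eqv_def]] dvd_diff[OF assms[unfolded eqv_def]]
  by (simp_all add: eqv_def algebra_simps)

text \<open>The known congruence makes y + j an odd multiple of 2^v together with x + j; equal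
  letters there fix one more binary digit of the difference.\<close>

lemma half_lift:
  assumes "occ_at b4 x u" "occ_at b4 y u" "j < length u"
    and "(x + j) mod 2 ^ Suc v = 2 ^ v" "eqv (Suc v) (int x) (int y)"
  shows "eqv (Suc (Suc v)) (int x) (int y)"
proof -
  have "eqv (Suc v) (int (x + j)) (int (y + j))" using assms(5) by (simp add: eqv_def)
  then have "(y + j) mod 2 ^ Suc v = 2 ^ v" using assms(4) by (simp only: eqv_nat)
  moreover have "hi (x + j) = hi (y + j)" using occ_at_eq[OF assms(1-3)] b4_eq_iff by blast
  ultimately have "eqv (Suc (Suc v)) (int (x + j)) (int (y + j))"
    using hi_half assms(4) eqv_nat by blast
  then show ?thesis by (simp add: eqv_def)
qed

lemma parity_eqv:
  assumes "occ_at b4 x u" "occ_at b4 y u" "u \<noteq> []"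
  shows "eqv 1 (int x) (int y)"
proof -
  have "b4 (x + 0) = b4 (y + 0)" by (rule occ_at_eq[OF assms(1,2)]) (use assms(3) in simp)
  then show ?thesis using b4_eq_iff by (simp add: eqv_def)
qed

lemma half_exists:
  obtains j where "j < 2 ^ Suc v" "(x + j) mod 2 ^ Suc v = (2 :: nat) ^ v"
proof -
  define M r h where "M = (2 :: nat) ^ Suc v" and "r = x mod M" and "h = (2 :: nat) ^ v"
  have r: "r < M" and h: "h < M" by (simp_all add: M_def r_def h_def)
  define j where "j = (if r \<le> h then h - r else h + M - r)"
  have "r + j = h \<or> r + j = h + M" using r by (auto simp: j_def)
  then have "(r + j) mod M = h" using h by auto
  then have "(x + j) mod M = h" by (simp only: r_def mod_add_left_eq)
  moreover have "j < M" using h r by (auto simp: j_def)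
  ultimately show thesis using that by (simp only: M_def h_def)
qed

lemma eqv_0_iff: "eqv v (int n) 0 \<longleftrightarrow> 2 ^ v dvd n"
  by (simp add: eqv_def) (metis int_dvd_int_iff of_nat_numeral of_nat_power)

lemma not_all_eqv:
  assumes "\<And>v. eqv (Suc v) (int n) 0" "n > 0"
  shows False
proof -
  have "2 ^ Suc n dvd n" using assms(1)[of n] by (simp only: eqv_0_iff)
  then have "2 ^ Suc n \<le> n" using assms(2) dvd_imp_le by blast
  moreover have "n < 2 ^ n" by simp
  ultimately show False by simp
qed

lemma eqv_ge: "eqv v (int n) 0 \<Longrightarrow> n > 0 \<Longrightarrow> 2 ^ v \<le> n"
  by (simp add: eqv_0_iff dvd_imp_le)

text \<open>A congruence depends only on the difference of its sides. Most uses below rewrite a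
  linear combination of congruences, over the integers, into the wanted form.\<close>

lemma eqvI:
  assumes "eqv v x y" "x' - y' = x - y"
  shows "eqv v x' y'"
  using assms by (simp add: eqv_def)

lemma eqv_sym: "eqv v x y \<Longrightarrow> eqv v y x"
  by (simp add: eqv_def dvd_diff_commute)

section \<open>The formula ADBDCDAD.DADCDBDA in \<open>b4\<close>\<close>

lemma b4_avoids_1: "avoids b4 {[A,D,B,D,C,D,A,D], [D,A,D,C,D,B,D,A]}"
  unfolding avoids_def
proof
  assume "\<exists>h. occurrence h {[A,D,B,D,C,D,A,D], [D,A,D,C,D,B,D,A]} b4"
  then obtain h where ne: "\<And>v. h v \<noteq> []"
    and f: "is_factor (morph h [A,D,B,D,C,D,A,D]) b4" "is_factor (morph h [D,A,D,C,D,B,D,A]) b4"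
    by (auto simp: occurrence_def nonerasing_def)
  define a b c d where "a = length (h A)" and "b = length (h B)" and "c = length (h C)" and "d = length (h D)"
  note len = a_def[symmetric] b_def[symmetric] c_def[symmetric] d_def[symmetric]
  have pos: "a > 0" "b > 0" "c > 0" "d > 0" using ne by (simp_all add: a_def b_def c_def d_def)
  obtain i r where "occ_at b4 i (morph h [A,D,B,D,C,D,A,D])" "occ_at b4 r (morph h [D,A,D,C,D,B,D,A])"
    using f is_factor_occ_at by blast
  then have A: "occ_at b4 i (h A)" "occ_at b4 (i + a + d + b + d + c + d) (h A)"
      "occ_at b4 (r + d) (h A)" "occ_at b4 (r + d + a + d + c + d + b + d) (h A)"
    and B: "occ_at b4 (i + a + d) (h B)" "occ_at b4 (r + d + a + d + c + d) (h B)"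
    and C: "occ_at b4 (i + a + d + b + d) (h C)" "occ_at b4 (r + d + a + d) (h C)"
    and D: "occ_at b4 (i + a) (h D)" "occ_at b4 (i + a + d + b) (h D)"
      "occ_at b4 (i + a + d + b + d + c) (h D)" "occ_at b4 (i + a + d + b + d + c + d + a) (h D)"
      "occ_at b4 r (h D)"
    by (simp_all add: morph_def len)
  \<comment> \<open>These congruences say that all listed occurrences of D are congruent:
    consecutive ones in the first fragment differ by b + d, c + d and a + d, and the last conjunct
    links the two fragments.\<close>
  define H where "H v \<longleftrightarrow> eqv v (int (a + d)) 0 \<and> eqv v (int (b + d)) 0 \<and> eqv v (int (c + d)) 0
    \<and> eqv v (int (i + a)) (int r)" for v
  have HD: "H v" if "\<And>x. occ_at b4 x (h D) \<Longrightarrow> x \<in> {i + a, i + a + d + b, i + a + d + b + d + c,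
      i + a + d + b + d + c + d + a, r} \<Longrightarrow> eqv v (int (i + a)) (int x)" for v
  proof -
    have 1: "eqv v (int (i + a)) (int (i + a + d + b))"
      and 2: "eqv v (int (i + a)) (int (i + a + d + b + d + c))"
      and 3: "eqv v (int (i + a)) (int (i + a + d + b + d + c + d + a))"
      and 4: "eqv v (int (i + a)) (int r)" using that D by blast+
    have b: "eqv v (int (b + d)) 0" by (rule eqvI[OF eqv_sym[OF 1]]) simp
    have c: "eqv v (int (c + d)) 0" by (rule eqvI[OF eqv_lin(2)[OF 1 2]]) simp
    have a: "eqv v (int (a + d)) 0" by (rule eqvI[OF eqv_lin(2)[OF 2 3]]) simp
    show ?thesis using a b c 4 by (simp add: H_def)
  qed
  have H: "H (Suc v)" for v
  proof (induction v)
    case 0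
    show ?case by (rule HD) (use parity_eqv[OF D(1)] ne in simp)
  next
    case (Suc v)
    let ?E = "eqv (Suc v)" and ?E' = "eqv (Suc (Suc v))"
    have h: "?E (int (a + d)) 0" "?E (int (b + d)) 0" "?E (int (c + d)) 0" "?E (int (i + a)) (int r)"
      using Suc by (simp_all add: H_def)
    \<comment> \<open>The first odd multiple of 2^v at or after the start of the first D; the
      question is whether D reaches it.\<close>
    obtain j where j: "j < 2 ^ Suc v" "(i + a + j) mod 2 ^ Suc v = 2 ^ v" by (rule half_exists)
    show ?case
    proof (cases "j < d")
      case True
      show ?thesis
      proof (rule HD)
        fix x assume x: "occ_at b4 x (h D)" "x \<in> {i + a, i + a + d + b, i + a + d + b + d + c,
          i + a + d + b + d + c + d + a, r}"
        have n: "?E 0 (int (b + d))" "?E 0 (int (c + d))" "?E 0 (int (a + d))"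
          using h eqv_sym by blast+
        have "?E (int (i + a)) (int (i + a))" by (simp add: eqv_def)
        moreover have "?E (int (i + a)) (int (i + a + d + b))"
          by (rule eqvI[OF n(1)]) simp
        moreover have "?E (int (i + a)) (int (i + a + d + b + d + c))"
          by (rule eqvI[OF eqv_lin(1)[OF n(1,2)]]) simp
        moreover have "?E (int (i + a)) (int (i + a + d + b + d + c + d + a))"
          by (rule eqvI[OF eqv_lin(1)[OF eqv_lin(1)[OF n(1,2)] n(3)]]) simp
        ultimately have "?E (int (i + a)) (int x)" using x(2) h(4) by blast
        then show "?E' (int (i + a)) (int x)"
          using half_lift[OF D(1) x(1), of j v] True j by (simp add: d_def)
      qed
    next
      case False
      then obtain l where l: "j = d + l" using le_Suc_ex not_less by blast
      \<comment> \<open>The sums a + d, b + d, c + d are positive multiples of 2^(v+1), hence larger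
        than j. If D misses the decisive position, then each of A, B, C placed after a D covers
        it.\<close>
      have ge: "j < a + d" "j < b + d" "j < c + d"
        using eqv_ge[OF h(1)] eqv_ge[OF h(2)] eqv_ge[OF h(3)] pos j(1) by linarith+
      then have la: "l < a" "l < b" "l < c" using l by auto
      have jr: "(r + d + l) mod 2 ^ Suc v = 2 ^ v"
      proof -
        have "?E (int (r + d + l)) (int (i + a + j))" by (rule eqvI[OF eqv_sym[OF h(4)]]) (simp add: l)
        then show ?thesis using j(2) by (simp only: eqv_nat)
      qed
      have jb: "(i + a + d + l) mod 2 ^ Suc v = 2 ^ v" using j(2) l by (simp add: add.assoc)
      have jc: "(i + a + d + b + d + l) mod 2 ^ Suc v = 2 ^ v"
      proof -
        have "?E (int (i + a + d + b + d + l)) (int (i + a + d + l))" by (rule eqvI[OF h(2)]) simp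
        then show ?thesis using jb by (simp only: eqv_nat)
      qed
      have A': "?E' (int (r + d)) (int y)" if "occ_at b4 y (h A)" "?E (int (r + d)) (int y)" for y
        using half_lift[OF A(3) that(1), of l v] la jr that(2) by (simp add: a_def)
      note s3 = eqv_lin(1)[OF eqv_lin(1)[OF h(1,2)] h(3)]
      have n4: "?E (int r) (int (i + a))" by (rule eqv_sym[OF h(4)])
      \<comment> \<open>Two congruences from A and one each from B and C form a linear system.
        Comparison with \<open>e1\<close>, a form of \<open>1\<close>, isolates c + d and b + d; the
        sum in \<open>2\<close> then yields a + d, and \<open>e1\<close> the offset between the
        fragments.\<close>
      have 1: "?E' (int (r + d)) (int i)"
        by (rule A'[OF A(1)], rule eqvI[OF eqv_lin(1)[OF n4 h(1)]]) simp
      have 2: "?E' (int (r + d)) (int (r + d + a + d + c + d + b + d))"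
        by (rule A'[OF A(4)], rule eqvI[OF eqv_lin(2)[OF eqv_lin(1)[OF h(4) n4] s3]]) simp
      have 3: "?E' (int (i + a + d)) (int (r + d + a + d + c + d))"
        by (rule half_lift[OF B(1,2), of l v]) (use la jb b_def in simp_all,
          rule eqvI[OF eqv_lin(2)[OF h(4) eqv_lin(1)[OF h(1,3)]]], simp)
      have 4: "?E' (int (i + a + d + b + d)) (int (r + d + a + d))"
        by (rule half_lift[OF C(1,2), of l v]) (use la jc c_def in simp_all,
          rule eqvI[OF eqv_lin(1)[OF h(4) eqv_lin(2)[OF h(2,1)]]], simp)
      have e1: "?E' (int (i + a)) (int (r + a + d))"
        by (rule eqvI[OF eqv_sym[OF 1]]) simp
      have gc: "?E' (int (c + d)) 0" by (rule eqvI[OF eqv_lin(2)[OF e1 3]]) simp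
      have gb: "?E' (int (b + d)) 0" by (rule eqvI[OF eqv_lin(2)[OF 4 e1]]) simp
      have nsum: "?E' (int (a + d + (b + d) + (c + d))) 0"
        by (rule eqvI[OF eqv_sym[OF 2]]) simp
      have ga: "?E' (int (a + d)) 0" by (rule eqvI[OF eqv_lin(2)[OF nsum eqv_lin(1)[OF gb gc]]]) simp
      have gr: "?E' (int (i + a)) (int r)" by (rule eqvI[OF eqv_lin(1)[OF e1 ga]]) simp
      show ?thesis using ga gb gc gr by (simp add: H_def)
    qed
  qed
  show False using not_all_eqv[of "b + d"] H pos by (simp add: H_def)
qed

text \<open>Two adjacent copies of u differ by the length of u. If this is a multiple of 2^(v+1),
  then u is long enough to cover an odd multiple of 2^v, so the congruence lifts forever.\<close>

lemma b4_square_free: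
  assumes "occ_at b4 x u" "occ_at b4 (x + length u) u" "u \<noteq> []"
  shows False
proof -
  have pos: "length u > 0" using assms(3) by simp
  have "eqv (Suc v) (int x) (int (x + length u))" for v
  proof (induction v)
    case 0
    show ?case using parity_eqv[OF assms] by simp
  next
    case (Suc v)
    have "eqv (Suc v) (int (length u)) 0" by (rule eqvI[OF eqv_sym[OF Suc]]) simp
    then have ge: "2 ^ Suc v \<le> length u" using eqv_ge pos by blast
    obtain j where j: "j < 2 ^ Suc v" "(x + j) mod 2 ^ Suc v = 2 ^ v" by (rule half_exists)
    show ?case by (rule half_lift[OF assms(1,2) _ j(2) Suc]) (use j(1) ge in linarith)
  qed
  then have "eqv (Suc v) (int (length u)) 0" for v by (rule eqvI[OF eqv_sym]) simp
  then show False using not_all_eqv pos by blast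
qed

section \<open>The formula ABACDBAC.CABDCABA in \<open>b4\<close>\<close>

lemma mod_power_Suc_eq:
  assumes "2 ^ n dvd z" "\<not> 2 ^ Suc n dvd z"
  shows "z mod 2 ^ Suc n = (2 :: nat) ^ n"
proof -
  obtain x where x: "z = 2 ^ n * x" using assms(1) by blast
  then have "odd x" using assms(2) by auto
  then have "x mod 2 = 1" by presburger
  then have "2 ^ n * x mod (2 ^ n * 2) = 2 ^ n" by (subst mod_mult_mult1) simp
  then show ?thesis by (simp add: x mult.commute)
qed

lemma b4_avoids_2: "avoids b4 {[A,B,A,C,D,B,A,C], [C,A,B,D,C,A,B,A]}"
  unfolding avoids_def
proof
  assume "\<exists>h. occurrence h {[A,B,A,C,D,B,A,C], [C,A,B,D,C,A,B,A]} b4"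
  then obtain h where ne: "\<And>v. h v \<noteq> []"
    and f: "is_factor (morph h [A,B,A,C,D,B,A,C]) b4" "is_factor (morph h [C,A,B,D,C,A,B,A]) b4"
    by (auto simp: occurrence_def nonerasing_def)
  define a b c d where "a = length (h A)" and "b = length (h B)" and "c = length (h C)" and "d = length (h D)"
  \<comment> \<open>S acts as a period: BAC recurs at distance S in the first fragment, and CAB in
    the second.\<close>
  define S where "S = a + b + c + d"
  note len = a_def[symmetric] b_def[symmetric] c_def[symmetric] d_def[symmetric]
  have pos: "a > 0" "b > 0" "c > 0" "d > 0" using ne by (simp_all add: a_def b_def c_def d_def)
  obtain i k where o: "occ_at b4 i (morph h [A,B,A,C,D,B,A,C])" "occ_at b4 k (morph h [C,A,B,D,C,A,B,A])"
    using f is_factor_occ_at by blast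
  have A: "occ_at b4 i (h A)" "occ_at b4 (i + a + b) (h A)" "occ_at b4 (i + a + b + S) (h A)"
      "occ_at b4 (k + c) (h A)" "occ_at b4 (k + c + S) (h A)" "occ_at b4 (k + c + a + b + S) (h A)"
    and B: "occ_at b4 (i + a) (h B)" "occ_at b4 (i + a + S) (h B)" "occ_at b4 (k + c + a) (h B)"
    and C: "occ_at b4 (i + a + b + a) (h C)" "occ_at b4 (i + a + b + a + S) (h C)" "occ_at b4 k (h C)"
    and D: "occ_at b4 (i + a + b + a + c) (h D)" "occ_at b4 (k + c + a + b) (h D)"
    using o by (simp_all add: morph_def len S_def add_ac)
  define H where "H v \<longleftrightarrow> eqv v (int (a + b)) 0 \<and> eqv v (int S) 0 \<and> eqv v (int (a + c)) 0
    \<and> eqv v (int (k + c)) (int i)" for v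
  have H: "H (Suc v)" for v
  proof (induction v)
    case 0
    have e: "eqv 1 (int (a + b)) 0" by (rule eqvI[OF parity_eqv[OF A(2,1)]]) (use ne in simp_all)
    have s: "eqv 1 (int S) 0" by (rule eqvI[OF parity_eqv[OF A(3,2)]]) (use ne in simp_all)
    have dl: "eqv 1 (int (k + c)) (int i)" by (rule parity_eqv[OF A(4,1)]) (use ne in simp)
    have cc: "eqv 1 (int (i + a + b + a)) (int k)" by (rule parity_eqv[OF C(1,3)]) (use ne in simp)
    have "eqv 1 (int (a + c)) 0"
      by (rule eqvI[OF eqv_lin(2)[OF eqv_lin(1)[OF cc dl] e]]) simp
    then show ?case using e s dl by (simp add: H_def)
  next
    case (Suc v)
    let ?M = "2 ^ Suc v :: nat"
    let ?E = "eqv (Suc v)" and ?E' = "eqv (Suc (Suc v))"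
    have h: "?E (int (a + b)) 0" "?E (int S) 0" "?E (int (a + c)) 0" "?E (int (k + c)) (int i)"
      using Suc by (simp_all add: H_def)
    \<comment> \<open>S - (a + b) - (a + c) = d - a. So a and d have the same residue, and the case
      split compares j with that residue instead of a: below it, A and D both cover the decisive
      position.\<close>
    have da: "?E (int d) (int a)"
      by (rule eqvI[OF eqv_lin(2)[OF h(2) eqv_lin(1)[OF h(1,3)]]]) (simp add: S_def)
    then have dma: "d mod ?M = a mod ?M" by (simp only: eqv_nat)
    obtain j where j: "j < ?M" "(i + j) mod ?M = 2 ^ v" by (rule half_exists)
    have e_if: "?E' (int (a + b)) 0" if "j < a"
      by (rule eqvI[OF eqv_sym[OF half_lift[OF A(1,2) _ j(2)]]], use that a_def in simp,
          rule eqvI[OF eqv_sym[OF h(1)]]) simp_all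
    have D_if: "?E' (int (i + a + b + a + c)) (int (k + c + a + b))" if "j < d"
    proof (rule half_lift[OF D(1,2), of j])
      have "?E (int (i + a + b + a + c + j)) (int (i + j))"
        by (rule eqvI[OF eqv_lin(1)[OF h(1,3)]]) simp
      then show "(i + a + b + a + c + j) mod ?M = 2 ^ v" using j(2) by (simp only: eqv_nat)
      show "?E (int (i + a + b + a + c)) (int (k + c + a + b))"
        by (rule eqvI[OF eqv_lin(2)[OF h(3,4)]]) simp
    qed (use that d_def in simp)
    show ?case
    proof (cases "j < a mod ?M")
      case True
      have ja: "j < a" "j < d"
        using True dma mod_less_eq_dividend[of a ?M] mod_less_eq_dividend[of d ?M] by linarith+
      have e: "?E' (int (a + b)) 0" by (rule e_if[OF ja(1)])
      have dl: "?E' (int i) (int (k + c))"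
        by (rule half_lift[OF A(1,4) _ j(2) eqv_sym[OF h(4)]]) (use ja a_def in simp)
      have "?E' (int i) (int (i + a + b + S))"
        by (rule half_lift[OF A(1,3) _ j(2)], use ja a_def in simp,
          rule eqvI[OF eqv_sym[OF eqv_lin(1)[OF h(1,2)]]]) simp
      then have s: "?E' (int S) 0" by (rule eqvI[OF eqv_lin(2)[OF eqv_sym e]]) simp
      have "?E' (int (a + c)) 0" by (rule eqvI[OF eqv_lin(2)[OF D_if[OF ja(2)] dl]]) simp
      then show ?thesis using e s eqv_sym[OF dl] by (simp add: H_def)
    next
      case False
      define l where "l = j - a mod ?M"
      have jl: "j = a mod ?M + l" using False by (simp add: l_def)
      have am: "?E (int a) (int (a mod ?M))" by (simp only: eqv_nat mod_mod_trivial)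
      \<comment> \<open>Both b and c are congruent to -a, so starting after the residue of a they
        reach at least the end of the window of length 2^(v+1).\<close>
      have lt: "l < n" if "?E (int (a + n)) 0" "n > 0" for n
      proof -
        have "?E (int (a mod ?M + n)) 0" by (rule eqvI[OF eqv_lin(2)[OF that(1) am]]) simp
        then have "?M \<le> a mod ?M + n" by (rule eqv_ge) (use that(2) in simp)
        then show ?thesis using j(1) jl by linarith
      qed
      have lb: "l < b" and lc: "l < c" using lt h pos by blast+
      have "?E (int (i + a + l)) (int (i + j))" by (rule eqvI[OF am]) (simp add: jl)
      then have bl: "(i + a + l) mod ?M = 2 ^ v" using j(2) by (simp only: eqv_nat)
      have "?E (int (i + a + b + a + l)) (int (i + a + l))" by (rule eqvI[OF h(1)]) simp
      then have cl: "(i + a + b + a + l) mod ?M = 2 ^ v" using bl by (simp only: eqv_nat)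
      have "?E' (int (i + a)) (int (i + a + S))"
        by (rule half_lift[OF B(1,2) _ bl], use lb b_def in simp, rule eqvI[OF eqv_sym[OF h(2)]]) simp
      then have s: "?E' (int S) 0" by (rule eqvI[OF eqv_sym]) simp
      have "?E' (int (i + a)) (int (k + c + a))"
        by (rule half_lift[OF B(1,3) _ bl], use lb b_def in simp, rule eqvI[OF eqv_sym[OF h(4)]]) simp
      then have dl: "?E' (int (k + c)) (int i)" by (rule eqvI[OF eqv_sym]) simp
      have cc: "?E' (int (i + a + b + a)) (int k)"
        by (rule half_lift[OF C(1,3) _ cl], use lc c_def in simp,
          rule eqvI[OF eqv_lin(2)[OF eqv_lin(1)[OF h(1,3)] h(4)]]) simp
      \<comment> \<open>B and C give only that (a + b) + (a + c) is divisible by 2^(v+2). If a + b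
        alone is not, the induction step cannot be completed and a contradiction is derived
        instead.\<close>
      show ?thesis
      proof (cases "?E' (int (a + b)) 0")
        case True
        have "?E' (int (a + c)) 0" by (rule eqvI[OF eqv_lin(2)[OF eqv_lin(1)[OF cc dl] True]]) simp
        then show ?thesis using True s dl by (simp add: H_def)
      next
        case ne2: False
        \<comment> \<open>An A or a D that reached offset j would lift a + b after all. Hence both
          are shorter than 2^(v+1), and their congruent lengths are equal.\<close>
        have "a < ?M" using e_if ne2 j(1) by (meson less_le_trans not_less)
        moreover have "d < ?M"
        proof (rule ccontr)
          assume "\<not> d < ?M"
          then have "?E' (int (i + a + b + a + c)) (int (k + c + a + b))" using D_if j(1) by simp
          then have "?E' (int (a + b)) 0" by (rule eqvI[OF eqv_lin(2)[OF cc]]) simp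
          then show False using ne2 by blast
        qed
        ultimately have ad: "d = a" "a \<le> j" using dma False by simp_all
        have D1: "occ_at b4 (i + S) (h D)" using D(1) by (simp add: S_def ad add_ac)
        have nd: "\<not> 2 ^ Suc (Suc v) dvd a + b" "?M dvd a + b" using ne2 h(1) by (simp_all only: eqv_0_iff) simp
        have s4: "eqv (Suc (Suc (Suc v))) (int S) 0"
          if "occ_at b4 x (h A)" "occ_at b4 (x + S) (h A)" "t < a" "(x + t) mod 2 ^ Suc (Suc v) = ?M" for x t
        proof -
          have "eqv (Suc (Suc (Suc v))) (int x) (int (x + S))"
            by (rule half_lift[OF that(1,2) _ that(4)], use that(3) a_def in simp, rule eqvI[OF eqv_sym[OF s]]) simp
          then show ?thesis by (rule eqvI[OF eqv_sym]) simp
        qed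
        have same: "b4 z = b4 (z + S)"
          if "eqv (Suc (Suc n)) (int S) 0" "z mod 2 ^ Suc n \<noteq> 0" for z n
        proof -
          have "eqv (Suc (Suc n)) (int z) (int (z + S))" by (rule eqvI[OF eqv_sym[OF that(1)]]) simp
          then have "z mod 2 ^ Suc (Suc n) = (z + S) mod 2 ^ Suc (Suc n)" by (simp only: eqv_nat)
          then have "hi z = hi (z + S)" using hi_periodic that(2) by blast
          moreover have "even S" using that(1) by (auto simp: eqv_0_iff elim: dvd_trans[rotated])
          ultimately show ?thesis by (simp add: b4_eq_iff)
        qed
        \<comment> \<open>With d = a the first D starts exactly S after the first A, so mostly it is
          enough that a letter of A recurs at distance S. Once A and D agree, the first fragment is
          the square of ABAC.\<close>
        have "h A = h D"
        proof (rule nth_equalityI)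
          show "length (h A) = length (h D)" using ad a_def d_def by simp
          fix t assume "t < length (h A)"
          then have t: "t < a" by (simp add: a_def)
          have At: "h A ! t = b4 (x + t)" if "occ_at b4 x (h A)" for x
            using that t a_def by (simp add: occ_at_def)
          have Dt: "h D ! t = b4 (x + t)" if "occ_at b4 x (h D)" for x
            using that t d_def ad by (simp add: occ_at_def)
          show "h A ! t = h D ! t"
          proof (cases "2 ^ v dvd i + t")
            case False
            then obtain n where n: "v = Suc n" by (cases v) auto
            then have "b4 (i + t) = b4 (i + t + S)" using same[of n "i + t"] h(2) False by (simp add: dvd_eq_mod_eq_0)
            then show ?thesis using At[OF A(1)] Dt[OF D1] by (simp add: add_ac)
          next
            case True
            \<comment> \<open>i + j is an odd multiple of 2^v, and t < a \<le> j leaves a gap below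
              2^(v+1), too small for a second one.\<close>
            have dM: "?M dvd i + t"
            proof (rule ccontr)
              assume "\<not> ?M dvd i + t"
              then have "(i + t) mod ?M = 2 ^ v" using mod_power_Suc_eq True by blast
              then have "?E (int (i + j)) (int (i + t))" using j(2) by (simp only: eqv_nat)
              then have "?E (int (j - t)) 0" by (rule eqvI) (use t ad in simp)
              then have "?M \<le> j - t" by (rule eqv_ge) (use t ad in simp)
              then show False using j(1) t ad by linarith
            qed
            show ?thesis
            proof (cases "2 ^ Suc (Suc v) dvd i + t")
              case False
              then have m: "(i + t) mod 2 ^ Suc (Suc v) = ?M" using mod_power_Suc_eq dM by blast
              \<comment> \<open>In the second fragment A recurs at distance S, and \<open>dl\<close>
                transfers the odd multiple of 2^(v+1) into it; this makes S divisible by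
                2^(v+3).\<close>
              have "?E' (int (k + c + t)) (int (i + t))" by (rule eqvI[OF dl]) simp
              then have "(k + c + t) mod 2 ^ Suc (Suc v) = ?M" using m by (simp only: eqv_nat)
              then have "eqv (Suc (Suc (Suc v))) (int S) 0" using s4[OF A(4,5) t] by blast
              then have "b4 (i + t) = b4 (i + t + S)" using same[of "Suc v" "i + t"] m by simp
              then show ?thesis using At[OF A(1)] Dt[OF D1] by (simp add: add_ac)
            next
              case True
              \<comment> \<open>Here i + t is too divisible for a direct comparison. Since a + b is
                an odd multiple of 2^(v+1), shifting by it gives a usable position; the last A and
                the D of the second fragment are compared there.\<close>
              have eq: "i + a + b + t = (a + b) + (i + t)" by simp
              have "?M dvd i + a + b + t" using nd(2) dM unfolding eq by (rule dvd_add)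
              moreover have "\<not> 2 ^ Suc (Suc v) dvd i + a + b + t"
                using dvd_add_left_iff[OF True, of "a + b"] nd(1) unfolding eq by blast
              ultimately have m: "(i + a + b + t) mod 2 ^ Suc (Suc v) = ?M" using mod_power_Suc_eq by blast
              then have s8: "eqv (Suc (Suc (Suc v))) (int S) 0" using s4[OF A(2,3) t] by blast
              have "?E' (int (k + c + a + b + t)) (int (i + a + b + t))" by (rule eqvI[OF dl]) simp
              then have "(k + c + a + b + t) mod 2 ^ Suc (Suc v) = ?M" using m by (simp only: eqv_nat)
              then have "b4 (k + c + a + b + t) = b4 (k + c + a + b + t + S)"
                using same[of "Suc v" "k + c + a + b + t"] s8 by simp
              then show ?thesis using At[OF A(6)] Dt[OF D(2)] by (simp add: add_ac)
            qed
          qed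
        qed
        then have "occ_at b4 i (h A @ h B @ h A @ h C)"
          "occ_at b4 (i + length (h A @ h B @ h A @ h C)) (h A @ h B @ h A @ h C)"
          using o(1) ad by (simp_all add: morph_def len add_ac)
        then have False by (rule b4_square_free) (use ne in simp)
        then show ?thesis ..
      qed
    qed
  qed
  show False using not_all_eqv[of S] H pos by (simp add: H_def S_def)
qed

section \<open>The pattern checker\<close>

fun theta :: "letter3 \<Rightarrow> letter3 list" where
  "theta K0 = [K2]"
| "theta K1 = [K0]"
| "theta K2 = [K0, K1]"

text \<open>A pattern is a list of fragments. The token \<open>Vr v\<close> stands for the image of the variable
  \<open>v\<close>, the token \<open>Pv v\<close> for \<open>\<theta>\<close> of the image of the same variable one level up.\<close>
datatype tok = Lt letter3 | Vr var | Pv var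

text \<open>Continuations that never follow the given letter, either in \<open>z3\<close> or in its
  image under \<open>theta\<close>; this is established in \<open>good_factor\<close>.\<close>

fun forb :: "letter3 \<Rightarrow> letter3 list list" where
  "forb K0 = [[K2,K2], [K0,K0], [K0,K2], [K2,K0,K1], [K2,K0,K2]]"
| "forb K1 = [[K1], [K0,K0], [K0,K2], [K2,K0,K2], [K0,K1,K0]]"
| "forb K2 = [[K1], [K2,K2], [K2,K0,K1], [K0,K1,K0]]"

text \<open>Since \<open>code_simp\<close> evaluates both branches of a conditional, the checker branches by
  pattern matching on Boolean arguments of auxiliary functions.\<close>
fun starts :: "letter3 list \<Rightarrow> tok list \<Rightarrow> bool"
  and starts_aux :: "bool \<Rightarrow> letter3 list \<Rightarrow> tok list \<Rightarrow> bool" where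
  "starts [] g = True"
| "starts (c # w) [] = False"
| "starts (c # w) (t # g) = starts_aux (t = Lt c) w g"
| "starts_aux True w g = starts w g"
| "starts_aux False w g = False"

fun some_starts :: "letter3 list list \<Rightarrow> tok list \<Rightarrow> bool"
  and some_starts_aux :: "bool \<Rightarrow> letter3 list list \<Rightarrow> tok list \<Rightarrow> bool" where
  "some_starts [] g = False"
| "some_starts (w # ws) g = some_starts_aux (starts w g) ws g"
| "some_starts_aux True ws g = True"
| "some_starts_aux False ws g = some_starts ws g"

text \<open>Only literal letters are compared with \<open>forb\<close>. The test on
  \<open>Pv\<close> relies on the normal form produced by \<open>choices\<close>: a block ending in
  0 is always followed by a literal 0, so no block can precede a 1.\<close>

fun ok :: "tok list \<Rightarrow> bool" and ok_aux :: "bool \<Rightarrow> tok list \<Rightarrow> bool" where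
  "ok [] = True"
| "ok (Lt c # g) = ok_aux (some_starts (forb c) g) g"
| "ok (Vr v # g) = ok g"
| "ok (Pv v # g) = ok_aux (starts [K1] g) g"
| "ok_aux True g = False"
| "ok_aux False g = ok g"

fun okall :: "tok list list \<Rightarrow> bool" and okall_aux :: "bool \<Rightarrow> tok list list \<Rightarrow> bool" where
  "okall [] = True"
| "okall (g # gs) = okall_aux (ok g) gs"
| "okall_aux True gs = okall gs"
| "okall_aux False gs = False"

fun keep :: "bool \<Rightarrow> 'a \<Rightarrow> 'a list \<Rightarrow> 'a list" where
  "keep True x xs = x # xs"
| "keep False x xs = xs"

fun sieve :: "tok list list list \<Rightarrow> tok list list list" where
  "sieve [] = []"
| "sieve (x # xs) = keep (okall x) x (sieve xs)"

fun sub :: "var \<Rightarrow> tok list \<Rightarrow> tok list \<Rightarrow> tok list"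
  and sub_aux :: "bool \<Rightarrow> tok list \<Rightarrow> tok \<Rightarrow> tok list \<Rightarrow> tok list" where
  "sub v q [] = []"
| "sub v q (t # g) = sub_aux (t = Vr v) q t (sub v q g)"
| "sub_aux True q t r = q @ r"
| "sub_aux False q t r = t # r"

text \<open>The shapes record whether an initial 1 and a final 0 have been cut off; in the last
  three nothing remains in between. A variable that does not occur gets one dummy choice, which
  avoids branching.\<close>

fun choices :: "bool \<Rightarrow> var \<Rightarrow> tok list list" where
  "choices True v = [[Pv v], [Pv v, Lt K0], [Lt K1, Pv v], [Lt K1, Pv v, Lt K0],
     [Lt K0], [Lt K1], [Lt K1, Lt K0]]"
| "choices False v = [[Pv v]]"

text \<open>Parsing starts at a block border. After a 0 the next token decides between the blocks 0
  and 01; at the end of the fragment both remain possible. A 1 at a border and an unsubstituted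
  variable have no parse.\<close>

fun par :: "tok list \<Rightarrow> tok list list" and par0 :: "tok list \<Rightarrow> tok list list" where
  "par [] = [[]]"
| "par (Lt K0 # g) = par0 g"
| "par (Lt K1 # g) = []"
| "par (Lt K2 # g) = map (Cons (Lt K0)) (par g)"
| "par (Vr v # g) = []"
| "par (Pv v # g) = map (Cons (Vr v)) (par g)"
| "par0 [] = [[Lt K1], [Lt K2]]"
| "par0 (Lt K1 # g) = map (Cons (Lt K2)) (par g)"
| "par0 (Lt K0 # g) = map (Cons (Lt K1)) (par (Lt K0 # g))"
| "par0 (Lt K2 # g) = map (Cons (Lt K1)) (par (Lt K2 # g))"
| "par0 (Vr v # g) = []"
| "par0 (Pv v # g) = map (Cons (Lt K1)) (par (Pv v # g))"

text \<open>A fragment beginning with 1 starts inside a block 01; restoring the 0 contributes a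
  letter 2.\<close>

fun desub :: "tok list \<Rightarrow> tok list list" where
  "desub (Lt K1 # g) = map (Cons (Lt K2)) (par g)"
| "desub g = par g"

fun prods :: "tok list list list \<Rightarrow> tok list list list" where
  "prods [] = [[]]"
| "prods (xs # xss) = concat (map (\<lambda>x. map (Cons x) (prods xss)) xs)"

fun expand :: "var list \<Rightarrow> tok list list \<Rightarrow> tok list list list" where
  "expand [] N = sieve (prods (map desub N))"
| "expand (v # vs) N = concat (map (expand vs)
     (sieve (map (\<lambda>q. map (sub v q) N) (choices (Vr v \<in> set (concat N)) v))))"

text \<open>A partial substitution for the four variables. The empty list means unassigned, which is
  unambiguous because variables are only matched with non-empty lists.\<close>

datatype sg = Sg "tok list" "tok list" "tok list" "tok list"

fun look :: "var \<Rightarrow> sg \<Rightarrow> tok list" where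
  "look A (Sg a b c d) = a"
| "look B (Sg a b c d) = b"
| "look C (Sg a b c d) = c"
| "look D (Sg a b c d) = d"

fun upd :: "var \<Rightarrow> tok list \<Rightarrow> sg \<Rightarrow> sg" where
  "upd A x (Sg a b c d) = Sg x b c d"
| "upd B x (Sg a b c d) = Sg a x c d"
| "upd C x (Sg a b c d) = Sg a b x d"
| "upd D x (Sg a b c d) = Sg a b c x"

fun strip :: "tok list \<Rightarrow> tok list \<Rightarrow> tok list option"
  and strip_aux :: "bool \<Rightarrow> tok list \<Rightarrow> tok list \<Rightarrow> tok list option" where
  "strip [] ts = Some ts"
| "strip (y # ys) [] = None"
| "strip (y # ys) (t # ts) = strip_aux (y = t) ys ts"
| "strip_aux True ys ts = strip ys ts"
| "strip_aux False ys ts = None"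

fun cons_fst :: "tok \<Rightarrow> (tok list \<times> tok list) list \<Rightarrow> (tok list \<times> tok list) list" where
  "cons_fst t [] = []"
| "cons_fst t ((a, b) # xs) = (t # a, b) # cons_fst t xs"

text \<open>Candidate values for an unassigned variable. The bound, four in \<open>mt\<close>,
  limits only the search: soundness concerns the matches that are found.\<close>

fun splits :: "nat \<Rightarrow> tok list \<Rightarrow> (tok list \<times> tok list) list" where
  "splits 0 ts = []"
| "splits (Suc k) [] = []"
| "splits (Suc k) (t # ts) = ([t], ts) # cons_fst t (splits k ts)"

function (sequential) mt :: "tok list \<Rightarrow> tok list \<Rightarrow> sg \<Rightarrow> sg list"
  and mt_lt :: "bool \<Rightarrow> tok list \<Rightarrow> tok list \<Rightarrow> sg \<Rightarrow> sg list"
  and mt_var :: "tok list \<Rightarrow> var \<Rightarrow> tok list \<Rightarrow> tok list \<Rightarrow> sg \<Rightarrow> sg list"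
  and mt_opt :: "tok list option \<Rightarrow> tok list \<Rightarrow> sg \<Rightarrow> sg list"
  and mt_split :: "(tok list \<times> tok list) list \<Rightarrow> var \<Rightarrow> tok list \<Rightarrow> sg \<Rightarrow> sg list" where
  "mt [] ts s = [s]"
| "mt (Lt c # p) [] s = []"
| "mt (Lt c # p) (t # ts) s = mt_lt (t = Lt c) p ts s"
| "mt (Vr v # p) ts s = mt_var (look v s) v p ts s"
| "mt (Pv v # p) ts s = []"
| "mt_lt True p ts s = mt p ts s"
| "mt_lt False p ts s = []"
| "mt_var [] v p ts s = mt_split (splits (Suc (Suc (Suc (Suc 0)))) ts) v p s"
| "mt_var (y # ys) v p ts s = mt_opt (strip (y # ys) ts) p s"
| "mt_opt None p s = []"
| "mt_opt (Some ts) p s = mt p ts s"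
| "mt_split [] v p s = []"
| "mt_split ((a, ts) # xs) v p s = mt p ts (upd v a s) @ mt_split xs v p s"

  by pat_completeness auto
termination
  by (relation "measures [
      case_sum (case_sum (\<lambda>(p, ts, s). length p) (\<lambda>(b, p, ts, s). length p))
        (case_sum (\<lambda>(y, v, p, ts, s). length p) (case_sum (\<lambda>(y, p, s). length p) (\<lambda>(x, v, p, s). length p))),
      case_sum (case_sum (\<lambda>_. 0) (\<lambda>_. 1)) (case_sum (\<lambda>_. 2) (\<lambda>_. 1)),
      case_sum (case_sum (\<lambda>_. 0) (\<lambda>_. 0)) (case_sum (\<lambda>_. 0) (case_sum (\<lambda>_. 0) (\<lambda>(x, v, p, s). length x)))]") auto

fun mt_suf :: "tok list \<Rightarrow> tok list \<Rightarrow> sg \<Rightarrow> sg list" where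
  "mt_suf p [] s = []"
| "mt_suf p (t # ts) s = mt p (t # ts) s @ mt_suf p ts s"

fun mt_any :: "tok list \<Rightarrow> tok list list \<Rightarrow> sg \<Rightarrow> sg list" where
  "mt_any p [] s = []"
| "mt_any p (g # gs) s = mt_suf p g s @ mt_any p gs s"

fun mt_all :: "tok list \<Rightarrow> tok list list \<Rightarrow> sg list \<Rightarrow> sg list" where
  "mt_all p gs [] = []"
| "mt_all p gs (s # ss) = mt_any p gs s @ mt_all p gs ss"

fun match_any :: "tok list list \<Rightarrow> tok list list \<Rightarrow> sg list \<Rightarrow> bool" where
  "match_any P N [] = False"
| "match_any [] N (s # ss) = True"
| "match_any (p # P) N (s # ss) = match_any P N (mt_all p N (s # ss))"

text \<open>Fragments are paired by index, unlike in \<open>match_any\<close>, so that end positions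
  do not grow and their sum can serve as the measure of descent.\<close>

fun match_each :: "tok list list \<Rightarrow> tok list list \<Rightarrow> sg list \<Rightarrow> bool" where
  "match_each P N [] = False"
| "match_each [] N (s # ss) = True"
| "match_each (p # P) [] (s # ss) = False"
| "match_each (p # P) (g # N) (s # ss) = match_each P N (mt_all p [g] (s # ss))"

fun known :: "tok list list list \<Rightarrow> tok list list \<Rightarrow> bool"
  and known_aux :: "bool \<Rightarrow> tok list list list \<Rightarrow> tok list list \<Rightarrow> bool" where
  "known [] N = False"
| "known (P # Ps) N = known_aux (match_any P N [Sg [] [] [] []]) Ps N"
| "known_aux True Ps N = True"
| "known_aux False Ps N = known Ps N"

fun hyp :: "tok list list list \<Rightarrow> tok list list \<Rightarrow> bool"
  and hyp_aux :: "bool \<Rightarrow> tok list list list \<Rightarrow> tok list list \<Rightarrow> bool" where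
  "hyp [] N = False"
| "hyp (P # Ps) N = hyp_aux (match_each P N [Sg [] [] [] []]) Ps N"
| "hyp_aux True Ps N = True"
| "hyp_aux False Ps N = hyp Ps N"

fun or_else :: "bool \<Rightarrow> tok list list list \<Rightarrow> tok list list \<Rightarrow> bool" where
  "or_else True Hs N = True"
| "or_else False Hs N = hyp Hs N"

text \<open>A state is refuted if it contains an instance of a pattern already known to be impossible,
  or of a pattern of \<open>Hs\<close> (which is excluded at earlier positions by induction), or if all its
  desubstitutions are refuted.\<close>
function (sequential) refuted ::
    "nat \<Rightarrow> tok list list list \<Rightarrow> tok list list list \<Rightarrow> tok list list \<Rightarrow> bool"
  and refuted_aux ::
    "bool \<Rightarrow> nat \<Rightarrow> tok list list list \<Rightarrow> tok list list list \<Rightarrow> tok list list \<Rightarrow> bool" where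
  "refuted n Ks Hs N = refuted_aux (or_else (or_else (known Ks N) Hs N) Hs (rev N)) n Ks Hs N"
| "refuted_aux True n Ks Hs N = True"
| "refuted_aux False 0 Ks Hs N = False"
| "refuted_aux False (Suc n) Ks Hs N = list_all (refuted n Ks Hs) (expand [A, B, C, D] N)"
  by pat_completeness auto
termination
  by (relation "measures [case_sum (\<lambda>(n, _). n) (\<lambda>(_, n, _). n), case_sum (\<lambda>_. 1) (\<lambda>_. 0)]") auto

section \<open>Soundness of desubstitution\<close>

text \<open>Two levels are interpreted at once: \<open>h\<close> for the current word and
  \<open>k\<close> for the word one level up. A desubstituted pattern has no \<open>Pv\<close> left
  and is read with \<open>k\<close> alone.\<close>

definition tval :: "(var \<Rightarrow> letter3 list) \<Rightarrow> (var \<Rightarrow> letter3 list) \<Rightarrow> tok \<Rightarrow> letter3 list" where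
  "tval h k t = (case t of Lt c \<Rightarrow> [c] | Vr v \<Rightarrow> h v | Pv v \<Rightarrow> morph theta (k v))"

definition val :: "(var \<Rightarrow> letter3 list) \<Rightarrow> (var \<Rightarrow> letter3 list) \<Rightarrow> tok list \<Rightarrow> letter3 list" where
  "val h k g = concat (map (tval h k) g)"

lemma tval_simps [simp]:
  "tval h k (Lt c) = [c]" "tval h k (Vr v) = h v" "tval h k (Pv v) = morph theta (k v)"
  by (simp_all add: tval_def)

lemma val_simps [simp]:
  "val h k [] = []" "val h k (t # g) = tval h k t @ val h k g"
  "val h k (g @ g') = val h k g @ val h k g'"
  by (simp_all add: val_def)

lemma morph_Nil [simp]: "morph f [] = []"
  by (simp add: morph_def)

lemma morph_Cons [simp]: "morph f (x # u) = f x @ morph f u"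
  by (simp add: morph_def)

lemma theta_ne [simp]: "theta c \<noteq> []"
  by (cases c) auto

lemma morph_theta_eq_Nil [simp]: "morph theta u = [] \<longleftrightarrow> u = []"
  by (cases u) auto

lemma hd_theta [simp]: "hd (theta c) \<noteq> K1"
  by (cases c) auto

lemma hd_morph_theta: "u \<noteq> [] \<Longrightarrow> hd (morph theta u) \<noteq> K1"
  by (cases u) auto

lemma last_morph_theta: "u \<noteq> [] \<Longrightarrow> last (morph theta u) = K0 \<longleftrightarrow> last u = K1"
proof (induction u)
  case (Cons c u)
  then show ?case by (cases "u = []"; cases c) auto
qed simp

text \<open>The image of 1 is a prefix of the image of 2, so \<open>theta\<close> is not a prefix
  code; forbidding an initial 1 in the remainders removes this ambiguity.\<close>

lemma theta_cancel:
  assumes "theta d @ x = theta c @ y" "x = [] \<or> hd x \<noteq> K1" "y = [] \<or> hd y \<noteq> K1"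
  shows "d = c \<and> x = y"
  using assms by (cases d; cases c) auto

lemma theta_split:
  assumes "morph theta x = morph theta a @ r" "r = [] \<or> hd r \<noteq> K1"
  obtains b where "x = a @ b" "r = morph theta b"
proof -
  have "\<exists>b. x = a @ b \<and> r = morph theta b" using assms
  proof (induction a arbitrary: x)
    case (Cons c a)
    then obtain d x' where x: "x = d # x'" by (cases x) auto
    have 1: "morph theta a @ r = [] \<or> hd (morph theta a @ r) \<noteq> K1"
      using Cons.prems(2) hd_morph_theta[of a] by (cases "a = []") auto
    have 2: "morph theta x' = [] \<or> hd (morph theta x') \<noteq> K1"
      using hd_morph_theta[of x'] by auto
    have 3: "theta d @ morph theta x' = theta c @ (morph theta a @ r)"
      using Cons.prems(1) x by simp
    have "d = c \<and> morph theta x' = morph theta a @ r"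
      by (rule theta_cancel[OF 3 2 1])
    then show ?case using Cons.IH[of x'] Cons.prems(2) x by auto
  qed simp
  then show thesis using that by blast
qed

definition good :: "letter3 list \<Rightarrow> bool" where
  "good x \<longleftrightarrow> (\<forall>a c w b. x = a @ c # w @ b \<longrightarrow> w \<notin> set (forb c))"

lemma good_append: "good (a @ b) \<Longrightarrow> good a \<and> good b"
  unfolding good_def by (metis append.assoc append_Cons)

text \<open>This consequence of \<open>good\<close> is all that parsing uses. It is kept separate
  because the absence of the words in \<open>forb\<close> is itself proved by desubstitution, which
  therefore cannot presuppose \<open>good\<close>.\<close>

definition adj :: "letter3 list \<Rightarrow> bool" where
  "adj x \<longleftrightarrow> (\<forall>a c b. x = a @ c # K1 # b \<longrightarrow> c = K0)"

lemma adj_append: "adj (a @ b) \<Longrightarrow> adj a \<and> adj b"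
  unfolding adj_def by (metis append.assoc append_Cons)

lemma adj_ConsD: "adj (c # x) \<Longrightarrow> adj x"
  using adj_append[of "[c]" x] by simp

lemma good_adj: "good (a @ c # K1 # b) \<Longrightarrow> c = K0"
proof (rule ccontr)
  assume g: "good (a @ c # K1 # b)" and "c \<noteq> K0"
  then have "[K1] \<in> set (forb c)" by (cases c) auto
  with g show False unfolding good_def by (metis append_Cons append_Nil)
qed

text \<open>An image block that ends in \<open>K0\<close> could be a truncated image of \<open>K2\<close>, unless the
  letter \<open>K0\<close> follows.\<close>
fun settled :: "(var \<Rightarrow> letter3 list) \<Rightarrow> tok list \<Rightarrow> bool" where
  "settled k [] = True"
| "settled k (Pv v # g) = ((last (k v) = K1 \<longrightarrow> (\<exists>r. g = Lt K0 # r)) \<and> settled k g)"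
| "settled k (t # g) = settled k g"

lemma settled_append: "settled k a \<Longrightarrow> settled k b \<Longrightarrow> settled k (a @ b)"
  by (induction k a rule: settled.induct) auto

lemma starts_prefix: "starts w g \<Longrightarrow> \<exists>r. g = map Lt w @ r"
proof (induction w arbitrary: g)
  case (Cons c w)
  then show ?case by (cases g; cases "hd g = Lt c") auto
qed simp

lemma some_starts: "some_starts ws g \<Longrightarrow> \<exists>w\<in>set ws. starts w g"
proof (induction ws)
  case (Cons w ws)
  then show ?case by (cases "starts w g") auto
qed simp

lemma val_map_Lt [simp]: "val h k (map Lt w) = w"
  by (induction w) auto

lemma ok_aux_iff: "ok_aux b g \<longleftrightarrow> \<not> b \<and> ok g"
  by (cases b) auto

lemma good_ok:
  assumes "\<And>v. k v \<noteq> []" "good (val h k g)" "settled k g"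
  shows "ok g"
  using assms(2,3)
proof (induction g)
  case (Cons t g)
  have gg: "good (val h k g)" using Cons.prems(1) good_append[of "tval h k t" "val h k g"] by simp
  have sg: "settled k g" using Cons.prems(2) by (cases t) auto
  note IH = Cons.IH[OF gg sg]
  show ?case
  proof (cases t)
    case (Lt c)
    have "\<not> some_starts (forb c) g"
    proof
      assume "some_starts (forb c) g"
      then obtain w r where w: "w \<in> set (forb c)" "g = map Lt w @ r"
        using some_starts starts_prefix by blast
      then have "val h k (t # g) = [] @ c # w @ val h k r" using Lt by simp
      then show False using Cons.prems(1) w(1) unfolding good_def by blast
    qed
    then show ?thesis using IH Lt by (simp add: ok_aux_iff)
  next
    case (Vr v)
    then show ?thesis using IH by simp
  next
    case (Pv v)
    have "\<not> starts [K1] g"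
    proof
      assume "starts [K1] g"
      then obtain r where r: "g = Lt K1 # r" using starts_prefix[of "[K1]" g] by auto
      then have "last (k v) \<noteq> K1" using Cons.prems(2) Pv by auto
      then have l: "last (morph theta (k v)) \<noteq> K0" using last_morph_theta assms(1) by blast
      have "morph theta (k v) \<noteq> []" using assms(1) by simp
      then obtain a c where ac: "morph theta (k v) = a @ [c]" by (metis rev_exhaust)
      then have "good (a @ c # K1 # val h k r)" using Cons.prems(1) Pv r by simp
      then show False using good_adj l ac by fastforce
    qed
    then show ?thesis using IH Pv by (simp add: ok_aux_iff)
  qed
qed simp

lemma val_ne:
  assumes "\<And>v. k v \<noteq> []" "\<And>v. Vr v \<notin> set g" "g \<noteq> []"
  shows "val h k g \<noteq> []"
proof (cases g)
  case (Cons t r)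
  then show ?thesis using assms by (cases t) auto
qed (use assms in simp)

text \<open>\<open>suf\<close> is the 1 that completes a block 01 truncated at the end of the
  fragment. After a final \<open>Pv\<close> it must be empty, since \<open>settled\<close> then
  forbids the block to end in 0.\<close>

lemma par_sound:
  assumes k: "\<And>v. k v \<noteq> []"
    and "settled k g" "\<And>v. Vr v \<notin> set g" "adj (val h k g)"
    and "morph theta x = val h k g @ suf"
    and "suf = [] \<or> suf = [K1] \<and> g \<noteq> [] \<and> last (val h k g) = K0"
  shows "\<exists>g'\<in>set (par g). x = val k k g' \<and> (\<forall>v. Pv v \<notin> set g')"
  using assms(2-)
proof (induction "length g" arbitrary: g x rule: less_induct)
  case less
  note s = less.prems(1) and nv = less.prems(2) and gd = less.prems(3) and eq = less.prems(4)
    and suf = less.prems(5)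
  have vne: "val h k g' \<noteq> []" if "\<And>v. Vr v \<notin> set g'" "g' \<noteq> []" for g'
    using val_ne[of k g' h] k that by blast
  show ?case
  proof (cases g)
    case Nil
    then show ?thesis using eq suf by auto
  next
    case (Cons t g1)
    have nv1: "\<And>v. Vr v \<notin> set g1" using nv Cons by auto
    have s1: "settled k g1" using s Cons by (cases t) auto
    have gd1: "adj (val h k g1)" using gd Cons adj_append[of "tval h k t" "val h k g1"] by simp
    have hd1: "hd (val h k g1 @ suf) \<noteq> K1 \<or> val h k g1 @ suf = []"
      if "\<And>r. g1 \<noteq> Lt K1 # r" "g1 = [] \<Longrightarrow> suf = []"
    proof (cases g1)
      case Nil
      then show ?thesis using that by simp
    next
      case (Cons t2 g2)
      then show ?thesis using that nv1 hd_morph_theta[OF k] k by (cases t2) auto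
    qed
    have suf1: "suf = [] \<or> suf = [K1] \<and> g1 \<noteq> [] \<and> last (val h k g1) = K0"
      if "g1 = [] \<Longrightarrow> suf = []"
      using suf that vne[of g1] nv1 Cons by (cases "g1 = []") auto
    have step: "\<exists>g'\<in>set (par g1). y = val k k g' \<and> (\<forall>v. Pv v \<notin> set g')"
      if "morph theta y = val h k g1 @ suf" "g1 = [] \<Longrightarrow> suf = []" for y
      using less.hyps[of g1 y] Cons s1 nv1 gd1 that suf1 by simp
    show ?thesis
    proof (cases t)
      case (Vr v)
      then show ?thesis using nv Cons by auto
    next
      case (Pv v)
      have sufn: "suf = []" if "g1 = []"
        using s suf Cons Pv that last_morph_theta[OF k, of v] by auto
      have "g1 \<noteq> Lt K1 # r" for r
      proof
        assume r: "g1 = Lt K1 # r"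
        then have "last (k v) \<noteq> K1" using s Cons Pv by auto
        then have l: "last (morph theta (k v)) \<noteq> K0" using last_morph_theta k by blast
        have "morph theta (k v) \<noteq> []" using k by simp
        then obtain a c where ac: "morph theta (k v) = a @ [c]" by (metis rev_exhaust)
        then have "adj (a @ c # K1 # val h k r)" using gd Cons Pv r by simp
        then show False using l ac unfolding adj_def by (metis last_snoc)
      qed
      then obtain b where b: "x = k v @ b" "val h k g1 @ suf = morph theta b"
        using theta_split[of x "k v" "val h k g1 @ suf"] eq Cons Pv hd1 sufn by auto
      obtain g' where "g' \<in> set (par g1)" "b = val k k g'" "\<forall>v. Pv v \<notin> set g'"
        using step[of b] b sufn by auto
      then show ?thesis using b Cons Pv by (intro bexI[of _ "Vr v # g'"]) auto
    next
      case (Lt c)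
      show ?thesis
      proof (cases c)
        case K1
        then show ?thesis using eq Cons Lt hd_morph_theta[of x] by (cases "x = []") auto
      next
        case K2
        have sufn: "suf = []" if "g1 = []"
          using suf Cons Lt K2 that by auto
        obtain y where y: "x = K0 # y" "morph theta y = val h k g1 @ suf"
        proof -
          have e: "morph theta x = K2 # val h k g1 @ suf" using eq Cons Lt K2 by simp
          then obtain c' y where x: "x = c' # y" by (cases x) auto
          then have "c' = K0" using e by (cases c') auto
          then show thesis using that x e by simp
        qed
        then obtain g' where "g' \<in> set (par g1)" "y = val k k g'" "\<forall>v. Pv v \<notin> set g'"
          using step sufn by blast
        then show ?thesis using y Cons Lt K2 by (intro bexI[of _ "Lt K0 # g'"]) auto
      next
        case K0
        show ?thesis
        proof (cases g1)
          case Nil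
          have e: "morph theta x = K0 # suf" using eq \<open>g = t # g1\<close> Nil Lt K0 by simp
          then obtain c' y where x: "x = c' # y" by (cases x) auto
          have "hd (morph theta y) \<noteq> K1 \<or> y = []" using hd_morph_theta by blast
          then have "x = [K1] \<or> x = [K2]"
            using e x suf by (cases c') auto
          then show ?thesis using \<open>g = t # g1\<close> Nil Lt K0 by auto
        next
          case (Cons t2 g2)
          show ?thesis
          proof (cases "t2 = Lt K1")
            case True
            have nv2: "\<And>v. Vr v \<notin> set g2" using nv1 Cons by auto
            have sufn: "suf = []" if "g2 = []"
              using suf \<open>g = t # g1\<close> Cons Lt K0 True that by auto
            then have suf2: "suf = [] \<or> suf = [K1] \<and> g2 \<noteq> [] \<and> last (val h k g2) = K0"
              using suf vne[of g2] nv2 Cons \<open>g = t # g1\<close> True by (cases "g2 = []") auto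
            obtain y where y: "x = K2 # y" "morph theta y = val h k g2 @ suf"
            proof -
              have e: "morph theta x = K0 # K1 # val h k g2 @ suf"
                using eq \<open>g = t # g1\<close> Cons Lt K0 True by simp
              then obtain c' y where x: "x = c' # y" by (cases x) auto
              then have "c' = K2" using e hd_morph_theta[of y] by (cases c'; cases "y = []") auto
              then show thesis using that x e by simp
            qed
            obtain g' where "g' \<in> set (par g2)" "y = val k k g'" "\<forall>v. Pv v \<notin> set g'"
              using less.hyps[of g2 y] \<open>g = t # g1\<close> Cons y(2) nv2 s1 gd1 suf2 True
                adj_ConsD[of K1 "val h k g2"] by auto
            then show ?thesis using y \<open>g = t # g1\<close> Cons Lt K0 True
              by (intro bexI[of _ "Lt K2 # g'"]) auto
          next
            case False
            have sufn: "suf = []" if "g1 = []" using that Cons by simp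
            have "\<And>r. g1 \<noteq> Lt K1 # r" using False Cons by auto
            note h1 = hd1[OF this sufn]
            obtain y where y: "x = [K1] @ y" "val h k g1 @ suf = morph theta y"
              using theta_split[of x "[K1]" "val h k g1 @ suf"] eq \<open>g = t # g1\<close> Lt K0 h1 by auto
            obtain g' where g': "g' \<in> set (par g1)" "y = val k k g'" "\<forall>v. Pv v \<notin> set g'"
              using step[of y] y sufn by auto
            have "par0 g1 = map (Cons (Lt K1)) (par g1)"
              using Cons False nv1 by (cases g1 rule: par0.cases) auto
            then show ?thesis using g' y \<open>g = t # g1\<close> Lt K0
              by (intro bexI[of _ "Lt K1 # g'"]) auto
          qed
        qed
      qed
    qed
  qed
qed

lemma desub_sound:
  assumes k: "\<And>v. k v \<noteq> []" and s: "settled k g" and nv: "\<And>v. Vr v \<notin> set g"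
    and gd: "adj (val h k g)" and ne: "g \<noteq> []"
    and eq: "morph theta x = pre @ val h k g @ suf"
    and pre: "if hd (val h k g) = K1 then pre = [K0] else pre = []"
    and suf: "suf = [] \<or> suf = [K1] \<and> last (val h k g) = K0"
  shows "\<exists>g'\<in>set (desub g). x = val k k g' \<and> (\<forall>v. Pv v \<notin> set g')"
proof (cases "\<exists>r. g = Lt K1 # r")
  case True
  then obtain r where r: "g = Lt K1 # r" by blast
  have e: "morph theta x = K0 # K1 # val h k r @ suf" using eq pre r by simp
  then obtain c y where x: "x = c # y" by (cases x) auto
  then have "c = K2" using e hd_morph_theta[of y] by (cases c; cases "y = []") auto
  then have y: "morph theta y = val h k r @ suf" using e x by simp
  have "suf = [] \<or> suf = [K1] \<and> r \<noteq> [] \<and> last (val h k r) = K0"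
  proof (cases "r = []")
    case True
    then show ?thesis using suf r by auto
  next
    case False
    then have "val h k r \<noteq> []" using nv r val_ne[of k r h] k by auto
    then show ?thesis using suf r False by auto
  qed
  then obtain g' where "g' \<in> set (par r)" "y = val k k g'" "\<forall>v. Pv v \<notin> set g'"
    using par_sound[where k=k and h=h and g=r and x=y and suf=suf] k s nv gd r y adj_ConsD[of K1 "val h k r"] by auto
  then show ?thesis using x \<open>c = K2\<close> r by (intro bexI[of _ "Lt K2 # g'"]) auto
next
  case False
  obtain t g1 where g: "g = t # g1" using ne by (cases g) auto
  have "hd (val h k g) \<noteq> K1"
    using False g nv k hd_morph_theta[OF k] by (cases t) auto
  then have "pre = []" using pre by simp
  moreover have "desub g = par g"
    using False g by (cases g rule: desub.cases) auto
  ultimately show ?thesis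
    using par_sound[where k=k and h=h and g=g and x=x and suf=suf] k s nv gd eq suf ne by simp
qed

section \<open>Occurrences by end position, and the block structure of images under
  \<open>theta\<close>\<close>

definition ends :: "'a word \<Rightarrow> nat \<Rightarrow> 'a list \<Rightarrow> bool" where
  "ends w e x \<longleftrightarrow> length x \<le> e \<and> x = w [e - length x \<rightarrow> e]"

lemma subsequence_split:
  fixes w :: "'a word"
  assumes "i \<le> j" "j \<le> l"
  shows "w [i \<rightarrow> l] = w [i \<rightarrow> j] @ w [j \<rightarrow> l]"
proof -
  have "[i..<l] = [i..<j] @ [j..<l]" using assms upt_add_eq_append[of i j "l - j"] by simp
  then show ?thesis by (simp add: subsequence_def)
qed

declare morph_append [simp]

lemma ends_factor:
  assumes "ends w e (a @ x @ b)"
  shows "ends w (e - length b) x"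
proof -
  let ?s = "e - length (a @ x @ b)"
  have l: "length a + length x + length b \<le> e" using assms by (simp add: ends_def)
  have 1: "a @ (x @ b) = w [?s \<rightarrow> ?s + length a] @ w [?s + length a \<rightarrow> e]"
    using assms l subsequence_split[of ?s "?s + length a" e w] by (simp add: ends_def)
  have "length a = length (w [?s \<rightarrow> ?s + length a])" by simp
  then have "x @ b = w [?s + length a \<rightarrow> e]" using 1 by (metis append_eq_append_conv)
  then have 2: "x @ b = w [?s + length a \<rightarrow> e - length b] @ w [e - length b \<rightarrow> e]"
    using l subsequence_split[of "?s + length a" "e - length b" e w] by simp
  have "length x = length (w [?s + length a \<rightarrow> e - length b])" using l by simp
  then have "x = w [?s + length a \<rightarrow> e - length b]" using 2 by (metis append_eq_append_conv)
  moreover have "?s + length a = e - length b - length x" using l by simp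
  ultimately show ?thesis using l by (simp add: ends_def)
qed

lemma is_factor_iff_ends: "is_factor x w \<longleftrightarrow> (\<exists>e. ends w e x)"
proof
  assume "is_factor x w"
  then obtain i j where "x = w [i \<rightarrow> j]" by (auto simp: is_factor_def)
  \<comment> \<open>For j < i the factor is empty, and its end is taken to be 0.\<close>
  then have "ends w (if i \<le> j then j else 0) x" by (auto simp: ends_def subsequence_def)
  then show "\<exists>e. ends w e x" by blast
next
  assume "\<exists>e. ends w e x"
  then show "is_factor x w" by (auto simp: ends_def is_factor_def)
qed

definition ipos :: "letter3 word \<Rightarrow> nat \<Rightarrow> nat" where
  "ipos u n = length (morph theta (u [0 \<rightarrow> n]))"

lemma ipos_0 [simp]: "ipos u 0 = 0"
  by (simp add: ipos_def subsequence_def)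

lemma morph_prefix_Suc: "morph f (u [0 \<rightarrow> Suc n]) = morph f (u [0 \<rightarrow> n]) @ f (u n)"
  by (simp add: subsequence_def morph_append)

lemma ipos_Suc: "ipos u (Suc n) = ipos u n + (if u n = K2 then 2 else 1)"
  by (cases "u n") (simp_all add: ipos_def morph_prefix_Suc)

lemma ipos_mono: "m \<le> n \<Longrightarrow> ipos u m \<le> ipos u n"
  by (rule lift_Suc_mono_le) (simp add: ipos_Suc)

text \<open>Only the image of 2 has two letters, so each earlier 2 shifts the image by one. This is
  the source of the strict descent.\<close>

lemma ipos_ge: "ipos u n = n + card {i. i < n \<and> u i = K2}"
proof (induction n)
  case (Suc n)
  have "{i. i < Suc n \<and> u i = K2} = (if u n = K2 then insert n {i. i < n \<and> u i = K2} else {i. i < n \<and> u i = K2})"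
    by (auto simp: less_Suc_eq)
  then show ?case using Suc by (simp add: ipos_Suc)
qed simp

definition image_word :: "letter3 word \<Rightarrow> letter3 word" where
  "image_word u n = morph theta (u [0 \<rightarrow> Suc n]) ! n"

lemma is_morph_image_theta_iff:
  "is_morph_image theta u w \<longleftrightarrow> (\<forall>n. w [ipos u n \<rightarrow> ipos u (Suc n)] = theta (u n))"
proof
  assume im: "is_morph_image theta u w"
  show "\<forall>n. w [ipos u n \<rightarrow> ipos u (Suc n)] = theta (u n)"
  proof
    fix n
    have "morph theta (u [0 \<rightarrow> n]) = w [0 \<rightarrow> ipos u n]" for n
      using im by (auto simp: is_morph_image_def ipos_def)
    then have "w [0 \<rightarrow> ipos u (Suc n)] = w [0 \<rightarrow> ipos u n] @ theta (u n)"
      by (metis morph_prefix_Suc)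
    moreover have "w [0 \<rightarrow> ipos u (Suc n)] = w [0 \<rightarrow> ipos u n] @ w [ipos u n \<rightarrow> ipos u (Suc n)]"
      by (rule subsequence_split) (simp_all add: ipos_mono)
    ultimately show "w [ipos u n \<rightarrow> ipos u (Suc n)] = theta (u n)" by simp
  qed
next
  assume *: "\<forall>n. w [ipos u n \<rightarrow> ipos u (Suc n)] = theta (u n)"
  have "morph theta (u [0 \<rightarrow> n]) = w [0 \<rightarrow> ipos u n]" for n
  proof (induction n)
    case 0
    show ?case by (simp add: subsequence_def)
  next
    case (Suc n)
    then show ?case using * subsequence_split[of 0 "ipos u n" "ipos u (Suc n)" w]
      by (simp add: morph_prefix_Suc ipos_mono)
  qed
  then show "is_morph_image theta u w" by (auto simp: is_morph_image_def ipos_def)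
qed

lemma image_word: "is_morph_image theta u (image_word u)"
  unfolding is_morph_image_def
proof
  fix n
  let ?p = "\<lambda>n. morph theta (u [0 \<rightarrow> n])"
  have pre: "\<exists>t. ?p (n + d) = ?p n @ t" for n d
    by (induction d) (auto simp: morph_prefix_Suc)
  have nth: "?p n ! i = image_word u i" if "i < length (?p n)" for i
  proof -
    have i: "i < length (?p (Suc i))" using ipos_ge[of u "Suc i"] by (simp add: ipos_def)
    obtain t where "?p (max n (Suc i)) = ?p n @ t"
      using pre[of n "max n (Suc i) - n"] by auto
    moreover obtain t' where "?p (max n (Suc i)) = ?p (Suc i) @ t'"
      using pre[of "Suc i" "max n (Suc i) - Suc i"] by auto
    ultimately have "?p n ! i = ?p (Suc i) ! i" using that i by (metis nth_append)
    then show ?thesis by (simp add: image_word_def)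
  qed
  show "?p n = image_word u [0 \<rightarrow> length (?p n)]"
    by (rule nth_equalityI) (simp_all add: nth)
qed

lemma theta_theta: "morph theta (theta c) = z3_morph c"
  by (cases c) auto

lemma morph_theta_theta: "morph theta (morph theta x) = morph z3_morph x"
  by (induction x) (simp_all add: morph_append theta_theta)

text \<open>\<open>theta\<close> applied twice is the morphism of \<open>z3\<close>. A prefix of the
  middle word is extended to the image of a prefix of \<open>z3\<close>, for which the fixed point
  equation is available.\<close>

lemma image_word_image_word: "is_morph_image theta (image_word z3) z3"
proof -
  let ?v = "image_word z3"
  have v: "morph theta (z3 [0 \<rightarrow> m]) = ?v [0 \<rightarrow> ipos z3 m]" for m
    using image_word[of z3] by (simp add: is_morph_image_def ipos_def)
  have z: "morph z3_morph (z3 [0 \<rightarrow> m]) = z3 [0 \<rightarrow> length (morph z3_morph (z3 [0 \<rightarrow> m]))]" for m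
    using z3_fixed_point by (simp add: is_morph_image_def)
  show ?thesis unfolding is_morph_image_def
  proof
    fix n
    have "n \<le> ipos z3 n" by (simp add: ipos_ge)
    then have "?v [0 \<rightarrow> ipos z3 n] = ?v [0 \<rightarrow> n] @ ?v [n \<rightarrow> ipos z3 n]"
      by (intro subsequence_split) auto
    then have e: "morph z3_morph (z3 [0 \<rightarrow> n]) = morph theta (?v [0 \<rightarrow> n]) @ morph theta (?v [n \<rightarrow> ipos z3 n])"
      using v[of n] by (metis morph_append morph_theta_theta)
    let ?l = "length (morph theta (?v [0 \<rightarrow> n]))"
    have "?l \<le> length (morph z3_morph (z3 [0 \<rightarrow> n]))" using e by simp
    then have "z3 [0 \<rightarrow> length (morph z3_morph (z3 [0 \<rightarrow> n]))] =
        z3 [0 \<rightarrow> ?l] @ z3 [?l \<rightarrow> length (morph z3_morph (z3 [0 \<rightarrow> n]))]"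
      by (intro subsequence_split) auto
    then have "morph theta (?v [0 \<rightarrow> n]) @ morph theta (?v [n \<rightarrow> ipos z3 n]) =
        z3 [0 \<rightarrow> ?l] @ z3 [?l \<rightarrow> length (morph z3_morph (z3 [0 \<rightarrow> n]))]"
      using z[of n] e by simp
    then show "morph theta (?v [0 \<rightarrow> n]) = z3 [0 \<rightarrow> ?l]"
      by (simp add: append_eq_append_conv)
  qed
qed

lemma ipos_block:
  assumes "is_morph_image theta u w"
  shows "w (ipos u n) = hd (theta (u n))" "u n = K2 \<Longrightarrow> w (Suc (ipos u n)) = K1"
proof -
  have e: "w [ipos u n \<rightarrow> ipos u (Suc n)] = theta (u n)"
    using assms is_morph_image_theta_iff by blast
  have lt: "ipos u n < ipos u (Suc n)" by (simp add: ipos_Suc)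
  then have c: "w [ipos u n \<rightarrow> ipos u (Suc n)] = w (ipos u n) # map w [Suc (ipos u n)..<ipos u (Suc n)]"
    by (simp add: subsequence_def upt_conv_Cons)
  then show "w (ipos u n) = hd (theta (u n))" using e by (metis list.sel(1))
  show "w (Suc (ipos u n)) = K1" if "u n = K2"
    using c e that by (simp add: ipos_Suc)
qed

text \<open>Since \<open>K1\<close> occurs only as the second letter of the image of \<open>K2\<close>, the blocks of
  \<open>w\<close> start exactly at the letters different from \<open>K1\<close>.\<close>
lemma block_of:
  assumes im: "is_morph_image theta u w"
  obtains n where "w m \<noteq> K1" "m = ipos u n"
  | n where "w m = K1" "m = Suc (ipos u n)" "u n = K2"
proof -
  have "\<exists>n. ipos u n \<le> m \<and> m < ipos u (Suc n)"
  proof (induction m)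
    case 0
    show ?case by (rule exI[of _ 0]) (simp add: ipos_Suc)
  next
    case (Suc m)
    then obtain n where n: "ipos u n \<le> m" "m < ipos u (Suc n)" by blast
    show ?case
    proof (cases "Suc m < ipos u (Suc n)")
      case True
      then show ?thesis using n by (intro exI[of _ n]) auto
    next
      case False
      then show ?thesis using n by (intro exI[of _ "Suc n"]) (simp add: ipos_Suc[of u "Suc n"])
    qed
  qed
  then obtain n where n: "ipos u n \<le> m" "m < ipos u (Suc n)" by blast
  then have "m = ipos u n \<or> m = Suc (ipos u n) \<and> u n = K2"
    by (cases "u n = K2") (auto simp: ipos_Suc)
  then consider "m = ipos u n" | "m = Suc (ipos u n)" "u n = K2" by blast
  then show thesis
  proof cases
    case 1
    then have "w m \<noteq> K1" using ipos_block(1)[OF im, of n] by simp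
    then show thesis using 1 that(1) by blast
  next
    case 2
    then show thesis using ipos_block(2)[OF im, of n] that(2) by blast
  qed
qed

lemma morph_subsequence:
  assumes im: "is_morph_image theta u w" and "m \<le> n"
  shows "morph theta (u [m \<rightarrow> n]) = w [ipos u m \<rightarrow> ipos u n]"
proof -
  have p: "morph theta (u [0 \<rightarrow> n]) = w [0 \<rightarrow> ipos u n]" for n
    using im by (simp add: is_morph_image_def ipos_def)
  have "u [0 \<rightarrow> n] = u [0 \<rightarrow> m] @ u [m \<rightarrow> n]" by (rule subsequence_split) (use assms in auto)
  then have "w [0 \<rightarrow> ipos u n] = w [0 \<rightarrow> ipos u m] @ morph theta (u [m \<rightarrow> n])"
    using p[of n] p[of m] by (simp add: morph_append)
  moreover have "w [0 \<rightarrow> ipos u n] = w [0 \<rightarrow> ipos u m] @ w [ipos u m \<rightarrow> ipos u n]"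
    by (rule subsequence_split) (simp_all add: ipos_mono assms)
  ultimately show ?thesis by simp
qed

lemma ipos_less_iff: "ipos u m < ipos u n \<longleftrightarrow> m < n"
proof -
  have "strict_mono (ipos u)" by (simp add: strict_mono_Suc_iff ipos_Suc)
  then show ?thesis by (simp add: strict_mono_less)
qed

text \<open>Enlarging a factor to whole blocks adds at most a 0 on the left and a 1 on the right. An
  early 2 in u gives the strict decrease of ends from 4 on.\<close>

lemma cover:
  assumes im: "is_morph_image theta u w" and K2: "u 0 = K2 \<or> u 2 = K2"
    and x: "x \<noteq> []" "ends w e x"
  obtains x' e' pre suf where "x' \<noteq> []" "ends u e' x'" "e' \<le> e" "4 \<le> e \<Longrightarrow> e' < e"
    "morph theta x' = pre @ x @ suf" "if hd x = K1 then pre = [K0] else pre = []"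
    "suf = [] \<or> suf = [K1] \<and> last x = K0"
proof -
  define s where "s = e - length x"
  have se: "s < e" "x = w [s \<rightarrow> e]" using x by (cases x; simp add: ends_def s_def)+
  have hdx: "hd x = w s"
    using se subsequence_nth[of 0 e s w] x(1) by (simp add: hd_conv_nth)
  have lastx: "last x = w (e - 1)"
    using se subsequence_nth[of "e - 1 - s" e s w] x(1) by (simp add: last_conv_nth)
  obtain n pre where n: "ipos u n \<le> s" "w [ipos u n \<rightarrow> s] = pre" "if w s = K1 then pre = [K0] else pre = []"
  proof (cases rule: block_of[OF im, of s])
    case (1 n)
    then show thesis using that[of n "[]"] by (simp add: subsequence_def)
  next
    case (2 n)
    then show thesis using that[of n "[K0]"] ipos_block(1)[OF im, of n] by (simp add: subsequence_def)
  qed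
  \<comment> \<open>A prefix of three letters already contains a 2; shorter ones are covered by the
    condition 4 \<le> e.\<close>
  have strict: "0 < card {i. i < l \<and> u i = K2}" if "3 \<le> l" for l
  proof -
    have "0 \<in> {i. i < l \<and> u i = K2} \<or> 2 \<in> {i. i < l \<and> u i = K2}" using K2 that by auto
    then show ?thesis by (auto simp: card_gt_0_iff)
  qed
  obtain l suf where l: "e \<le> ipos u l" "w [e \<rightarrow> ipos u l] = suf" "suf = [] \<or> suf = [K1] \<and> w (e - 1) = K0"
    "l \<le> e" "4 \<le> e \<Longrightarrow> l < e"
  proof (cases rule: block_of[OF im, of e])
    case (1 l)
    have "l < e" if "4 \<le> e" using strict[of l] that 1 ipos_ge[of u l] by (cases "3 \<le> l") auto
    then show thesis using that[of l "[]"] 1 ipos_ge[of u l] by (simp add: subsequence_def)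
  next
    case (2 l)
    have i: "ipos u (Suc l) = Suc e" using 2 by (simp add: ipos_Suc)
    have lt: "Suc l < e" if "4 \<le> e"
    proof (cases "3 \<le> l")
      case True
      then show ?thesis using strict[of l] 2 ipos_ge[of u l] by linarith
    qed (use that in simp)
    have "w (e - 1) = K0" using 2 ipos_block(1)[OF im, of l] by simp
    then show thesis using that[of "Suc l" "[K1]"] 2 i lt ipos_ge[of u l] by (simp add: subsequence_def)
  qed
  have "ipos u n < ipos u l" using n l se by simp
  then have nl: "n < l" by (simp add: ipos_less_iff)
  have "morph theta (u [n \<rightarrow> l]) = w [ipos u n \<rightarrow> ipos u l]"
    by (rule morph_subsequence[OF im]) (use nl in simp)
  also have "\<dots> = pre @ x @ suf"
    using subsequence_split[of "ipos u n" s "ipos u l" w] subsequence_split[of s e "ipos u l" w] n l se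
    by simp
  finally have m: "morph theta (u [n \<rightarrow> l]) = pre @ x @ suf" .
  have ne: "u [n \<rightarrow> l] \<noteq> []" using nl by (simp add: subsequence_def)
  have en: "ends u l (u [n \<rightarrow> l])" using nl by (simp add: ends_def)
  show thesis
    by (rule that[OF ne en l(4,5) m]) (use n l hdx lastx in auto)
qed

section \<open>The two words exchanged by \<open>theta\<close>, and short words absent from
  both\<close>

definition zwords :: "letter3 word set" where
  "zwords = {z3, image_word z3}"

lemma zwords_cover:
  assumes "w \<in> zwords"
  obtains u where "u \<in> zwords" "is_morph_image theta u w" "u 0 = K2 \<or> u 2 = K2"
proof -
  let ?v = "image_word z3"
  have zp: "morph z3_morph (z3 [0 \<rightarrow> n]) = z3 [0 \<rightarrow> length (morph z3_morph (z3 [0 \<rightarrow> n]))]" for n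
    using z3_fixed_point by (simp add: is_morph_image_def)
  have z0: "z3 0 = K0" using z3_fixed_point by simp
  have z1: "z3 1 = K1" using zp[of 1] z0 by (simp add: subsequence_def upt_conv_Cons)
  have "z3 2 = K2" using zp[of 2] z0 z1 by (simp add: subsequence_def upt_conv_Cons numeral_2_eq_2)
  moreover have "?v 0 = K2" using z0 by (simp add: image_word_def subsequence_def)
  ultimately show thesis using assms that image_word[of z3] image_word_image_word
    by (auto simp: zwords_def)
qed

lemma no_K1_after:
  assumes "w \<in> zwords" "ends w e [c, K1]"
  shows "c = K0"
proof -
  obtain u where u: "is_morph_image theta u w" using assms zwords_cover by blast
  have "2 \<le> e" using assms(2) by (simp add: ends_def)
  then obtain m where e: "e = Suc (Suc m)" by (metis add_2_eq_Suc le_Suc_ex)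
  have c: "w m = c" "w (Suc m) = K1" using assms(2) e by (simp_all add: ends_def subsequence_def)
  show ?thesis
  proof (cases rule: block_of[OF u, of "Suc m"])
    case (1 n)
    then show ?thesis using c by simp
  next
    case (2 n)
    then show ?thesis using c ipos_block(1)[OF u, of n] by simp
  qed
qed

lemma adjacent_factor:
  assumes w: "w \<in> zwords" "ends w e x" and x: "x = a @ c # K1 # b"
  shows "c = K0"
  using ends_factor[of w e a "[c, K1]" b] w x no_K1_after by simp

lemma settled_const: "(\<And>v. Pv v \<notin> set g) \<Longrightarrow> settled k g"
  by (induction k g rule: settled.induct) auto

definition absent :: "letter3 list \<Rightarrow> bool" where
  "absent x \<longleftrightarrow> (\<forall>w\<in>zwords. \<forall>e. \<not> ends w e x)"

text \<open>A word is a pattern without variables, so \<open>desub\<close> lists its possible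
  parents, one of which would occur in a word of \<open>zwords\<close>. The constant substitutions
  are placeholders.\<close>

lemma absent_desub:
  assumes "x \<noteq> []" "\<forall>g\<in>set (desub (map Lt x)). absent (val (\<lambda>_. [K0]) (\<lambda>_. [K0]) g)"
  shows "absent x"
  unfolding absent_def
proof (intro ballI allI notI)
  fix w e assume w: "w \<in> zwords" "ends w e x"
  obtain u where u: "u \<in> zwords" "is_morph_image theta u w" "u 0 = K2 \<or> u 2 = K2"
    using zwords_cover[OF w(1)] .
  obtain x' e' pre suf where c: "ends u e' x'" "morph theta x' = pre @ x @ suf"
    "if hd x = K1 then pre = [K0] else pre = []" "suf = [] \<or> suf = [K1] \<and> last x = K0"
    using cover[OF u(2,3) assms(1) w(2)] by metis
  have "adj x" unfolding adj_def using adjacent_factor[OF w] by blast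
  then have "\<exists>g\<in>set (desub (map Lt x)). x' = val (\<lambda>_. [K0]) (\<lambda>_. [K0]) g \<and> (\<forall>v. Pv v \<notin> set g)"
    by (intro desub_sound[where h = "\<lambda>_. [K0]" and pre = pre and suf = suf] settled_const)
      (use c assms(1) in auto)
  then show False using assms(2) c(1) u(1) unfolding absent_def by blast
qed

lemma absent_K1:
  assumes "c \<noteq> K0"
  shows "absent (c # K1 # r)" "absent (d # c # K1 # r)"
proof -
  have 1: "absent (a @ c # K1 # r)" for a
    unfolding absent_def using assms adjacent_factor by blast
  show "absent (c # K1 # r)" "absent (d # c # K1 # r)" using 1[of "[]"] 1[of "[d]"] by simp_all
qed

text \<open>The groups are ordered so that every parent of a word either belongs to an earlier group
  or contains a 1 not preceded by 0.\<close>

lemma absent_short: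
  "absent [K1,K0,K0]" "absent [K1,K0,K2]" "absent [K0,K0,K0]" "absent [K0,K0,K2]"
  by (rule absent_desub; simp add: absent_K1)+

lemma absent_short':
  "absent [K2,K2,K2]" "absent [K0,K2,K2]" "absent [K0,K2,K0,K1]" "absent [K2,K2,K0,K1]"
  by (rule absent_desub; simp add: absent_K1 absent_short)+

lemma absent_short'':
  "absent [K2,K0,K1,K0]" "absent [K1,K0,K1,K0]"
  by (rule absent_desub; simp add: absent_K1 absent_short')+

lemma absent_short''':
  "absent [K0,K2,K0,K2]" "absent [K1,K2,K0,K2]"
  by (rule absent_desub; simp add: absent_short'')+

lemma good_factor:
  assumes w: "w \<in> zwords" "ends w e x"
  shows "good x"
  unfolding good_def
proof (intro allI impI notI)
  fix a c y b assume x: "x = a @ c # y @ b" and y: "y \<in> set (forb c)"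
  have "absent (c # y)" using y
    by (cases c) (auto simp: absent_K1 absent_short absent_short' absent_short'' absent_short''')
  then show False using ends_factor[of w e a "c # y" b] w x unfolding absent_def by simp
qed

section \<open>Expansion reaches the pattern of every actual parent\<close>

lemma okall_iff: "okall gs \<longleftrightarrow> (\<forall>g\<in>set gs. ok g)"
proof (induction gs)
  case (Cons g gs)
  then show ?case by (cases "ok g") auto
qed simp

lemma set_sieve: "set (sieve Ns) = {N \<in> set Ns. okall N}"
proof (induction Ns)
  case (Cons N Ns)
  then show ?case by (cases "okall N") auto
qed simp

lemma in_prods: "list_all2 (\<lambda>g gs. g \<in> set gs) M gss \<Longrightarrow> M \<in> set (prods gss)"
  by (induction M gss rule: list_all2_induct) auto

lemma val_sub: "val h k q = h v \<Longrightarrow> val h k (sub v q g) = val h k g"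
proof (induction g)
  case (Cons t g)
  then show ?case by (cases "t = Vr v") auto
qed simp

lemma Vr_sub: "Vr u \<in> set (sub v q g) \<Longrightarrow> Vr u \<in> set g \<and> u \<noteq> v \<or> Vr u \<in> set q"
proof (induction g)
  case (Cons t g)
  then show ?case by (cases "t = Vr v") auto
qed simp

lemma sub_id: "Vr v \<notin> set g \<Longrightarrow> sub v q g = g"
proof (induction g)
  case (Cons t g)
  then show ?case by (cases "t = Vr v") auto
qed simp

lemma sub_eq_Nil: "q \<noteq> [] \<Longrightarrow> sub v q g = [] \<longleftrightarrow> g = []"
proof (induction g)
  case (Cons t g)
  then show ?case by (cases "t = Vr v") auto
qed simp

lemma settled_sub: "settled k g \<Longrightarrow> settled k q \<Longrightarrow> settled k (sub v q g)"
proof (induction k g rule: settled.induct)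
  case (2 k u g)
  then show ?case by auto
next
  case ("3_2" k u g)
  then show ?case by (cases "u = v") (auto intro: settled_append)
qed auto

lemma choices_False: "q \<in> set (choices b v) \<Longrightarrow> q \<noteq> [] \<and> (\<forall>u. Vr u \<notin> set q)"
  by (cases b) auto

definition covers :: "(var \<Rightarrow> letter3 list) \<Rightarrow> (var \<Rightarrow> letter3 list) \<Rightarrow> tok list \<Rightarrow> letter3 list \<Rightarrow> bool" where
  "covers h k g x \<longleftrightarrow> (\<exists>pre suf. morph theta x = pre @ val h k g @ suf \<and>
    (if hd (val h k g) = K1 then pre = [K0] else pre = []) \<and>
    (suf = [] \<or> suf = [K1] \<and> last (val h k g) = K0))"

text \<open>Along the recursion the shape realised by \<open>h\<close> and \<open>k\<close> is
  chosen for each variable. It leaves \<open>val\<close> unchanged, so \<open>covers\<close>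
  persists, and pruning never removes this branch because all values stay
  \<open>good\<close>.\<close>

lemma expand_sound:
  assumes k: "\<And>v. k v \<noteq> []"
    and "\<forall>g\<in>set N. settled k g \<and> good (val h k g) \<and> g \<noteq> []"
    and "\<forall>v\<in>set vs. Vr v \<in> set (concat N) \<longrightarrow>
      (\<exists>q\<in>set (choices True v). val h k q = h v \<and> settled k q)"
    and "\<forall>v. Vr v \<in> set (concat N) \<longrightarrow> v \<in> set vs"
    and "list_all2 (covers h k) N xs" and xs: "\<forall>x\<in>set xs. good x"
  shows "\<exists>M\<in>set (expand vs N). list_all2 (\<lambda>g x. x = val k k g \<and> (\<forall>v. Pv v \<notin> set g)) M xs"
  using assms(2-5)
proof (induction vs arbitrary: N)
  case Nil
  let ?P = "\<lambda>g' x. x = val k k g' \<and> (\<forall>v. Pv v \<notin> set g')"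
  have *: "\<exists>g'\<in>set (desub g). ?P g' x" if "g \<in> set N" "covers h k g x" for g x
  proof -
    have "adj (val h k g)" using Nil.prems(1) that(1) good_adj unfolding adj_def by metis
    then show ?thesis using that Nil.prems(1,3) desub_sound[of k g h x] k
      unfolding covers_def by fastforce
  qed
  have "\<exists>M. list_all2 (\<lambda>g gs. g \<in> set gs) M (map desub N) \<and> list_all2 ?P M xs"
    using Nil.prems(4) *
  proof (induction N xs rule: list_all2_induct)
    case (Cons g gs x xs)
    then obtain M where "list_all2 (\<lambda>g gs. g \<in> set gs) M (map desub gs)" "list_all2 ?P M xs"
      by auto
    moreover obtain g' where "g' \<in> set (desub g)" "?P g' x" using Cons by auto
    ultimately show ?case by (intro exI[of _ "g' # M"]) auto
  qed auto
  then obtain M where M: "list_all2 (\<lambda>g gs. g \<in> set gs) M (map desub N)" "list_all2 ?P M xs" by blast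
  have "ok g" if gM: "g \<in> set M" for g
  proof -
    obtain i where i: "i < length M" "M ! i = g" using gM by (auto simp: in_set_conv_nth)
    have "xs ! i \<in> set xs" using list_all2_lengthD[OF M(2)] i(1) by simp
    moreover have "xs ! i = val k k g \<and> (\<forall>v. Pv v \<notin> set g)"
      using list_all2_nthD[OF M(2) i(1)] i(2) by simp
    ultimately show ?thesis using good_ok[of k k g] k xs settled_const[of g k] by auto
  qed
  then have "M \<in> set (expand [] N)" using in_prods[OF M(1)] by (simp add: set_sieve okall_iff)
  then show ?case using M(2) by blast
next
  case (Cons v vs)
  define b where "b \<longleftrightarrow> Vr v \<in> set (concat N)"
  obtain q where q: "q \<in> set (choices b v)"
    "\<forall>g\<in>set N. val h k (sub v q g) = val h k g" "\<forall>g\<in>set N. settled k (sub v q g)"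
  proof (cases b)
    case True
    have "v \<in> set (v # vs)" by simp
    from bspec[OF Cons.prems(2) this] True
    obtain q where q: "q \<in> set (choices True v)" "val h k q = h v" "settled k q"
      unfolding b_def by blast
    have 1: "\<forall>g\<in>set N. val h k (sub v q g) = val h k g" using val_sub[of h k q v, OF q(2)] by blast
    have 2: "\<forall>g\<in>set N. settled k (sub v q g)" using settled_sub[OF _ q(3)] Cons.prems(1) by blast
    have "b = True" using True by blast
    then show thesis using that[OF _ 1 2] q(1) by blast
  next
    case False
    have "sub v [Pv v] g = g" if g: "g \<in> set N" for g
    proof -
      have "Vr v \<notin> set g" using False g unfolding b_def by auto
      then show ?thesis by (rule sub_id)
    qed
    then show thesis using that[of "[Pv v]"] False Cons.prems(1) by simp
  qed
  let ?N = "map (sub v q) N"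
  have q0: "q \<noteq> []" "\<And>u. Vr u \<notin> set q" using choices_False[OF q(1)] by blast+
  have vars: "Vr u \<in> set (concat N) \<and> u \<noteq> v" if "Vr u \<in> set (concat ?N)" for u
    using that Vr_sub[of u v q] q0(2) by (simp, blast)
  have "ok (sub v q g)" if g: "g \<in> set N" for g
  proof (rule good_ok[of k h, OF k])
    show "good (val h k (sub v q g))" using q(2) Cons.prems(1) g by simp
    show "settled k (sub v q g)" using q(3) g by blast
  qed
  then have "okall ?N" by (simp add: okall_iff)
  then have "?N \<in> set (sieve (map (\<lambda>q. map (sub v q) N) (choices (Vr v \<in> set (concat N)) v)))"
    using q(1) unfolding set_sieve b_def set_map by blast
  moreover have "\<exists>M\<in>set (expand vs ?N). list_all2 (\<lambda>g x. x = val k k g \<and> (\<forall>v. Pv v \<notin> set g)) M xs"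
  proof (rule Cons.IH)
    show "\<forall>g\<in>set ?N. settled k g \<and> good (val h k g) \<and> g \<noteq> []"
      using q(2,3) Cons.prems(1) sub_eq_Nil[OF q0(1)] by simp
    show "\<forall>u\<in>set vs. Vr u \<in> set (concat ?N) \<longrightarrow>
      (\<exists>q\<in>set (choices True u). val h k q = h u \<and> settled k q)"
    proof (intro ballI impI)
      fix u assume u: "u \<in> set vs" "Vr u \<in> set (concat ?N)"
      have "u \<in> set (v # vs)" using u(1) by simp
      from bspec[OF Cons.prems(2) this] vars[OF u(2)]
      show "\<exists>q\<in>set (choices True u). val h k q = h u \<and> settled k q" by blast
    qed
    show "\<forall>u. Vr u \<in> set (concat ?N) \<longrightarrow> u \<in> set vs"
    proof (intro allI impI)
      fix u assume "Vr u \<in> set (concat ?N)"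
      from vars[OF this] Cons.prems(3) have "u \<in> set (v # vs)" "u \<noteq> v" by blast+
      then show "u \<in> set vs" by simp
    qed
    show "list_all2 (covers h k) ?N xs"
      using Cons.prems(4) q(2) by (simp add: list_all2_conv_all_nth covers_def)
  qed
  ultimately show ?case unfolding expand.simps set_concat set_map by blast
qed

text \<open>From the left, 01 is read as 2, any other 0 as 1, and 2 as 0; a 1 is always consumed
  together with its preceding 0.\<close>

lemma theta_preimage:
  assumes "adj x" "x = [] \<or> hd x \<noteq> K1"
  shows "\<exists>y. x = morph theta y"
  using assms
proof (induction "length x" arbitrary: x rule: less_induct)
  case less
  show ?case
  proof (cases x)
    case Nil
    then show ?thesis by (intro exI[of _ "[]"]) simp
  next
    case (Cons c r)
    have r: "adj r" using less.prems(1) Cons adj_ConsD by blast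
    show ?thesis
    proof (cases "\<exists>r'. r = K1 # r'")
      case True
      then obtain r' where r': "r = K1 # r'" by blast
      have "c = K0" using less.prems(1) Cons r' unfolding adj_def by (metis append_Nil)
      have "r' = [] \<or> hd r' \<noteq> K1"
        using less.prems(1) Cons r' unfolding adj_def
        by (metis append_Cons append_Nil letter3.distinct(1) list.collapse)
      then obtain y where "r' = morph theta y"
        using less.hyps[of r'] Cons r' adj_ConsD[of K1 r'] r by auto
      then show ?thesis using Cons r' \<open>c = K0\<close> by (intro exI[of _ "K2 # y"]) simp
    next
      case False
      then have "r = [] \<or> hd r \<noteq> K1" by (cases r) auto
      then obtain y where "r = morph theta y" using less.hyps[of r] Cons r by auto
      then show ?thesis using Cons less.prems(2)
        by (intro exI[of _ "(if c = K0 then K1 else K0) # y"]) (cases c; simp)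
    qed
  qed
qed

text \<open>The preimage y of one variable is found before the whole substitution is known.
  Quantifying over every \<open>k\<close> with \<open>k v = y\<close> allows the preimages of all
  variables to be combined afterwards.\<close>

lemma choice_exists:
  assumes "adj x" "x \<noteq> []"
  shows "\<exists>y. y \<noteq> [] \<and> (\<forall>h k. k v = y \<longrightarrow> (\<exists>q\<in>set (choices True v). val h k q = x \<and> settled k q))"
proof -
  obtain s r where s: "x = s @ r" "s = [] \<or> s = [K1]" "r = [] \<or> hd r \<noteq> K1"
  proof (cases "hd x = K1")
    case True
    then obtain r where r: "x = K1 # r" using assms(2) by (cases x) auto
    then have "r = [] \<or> hd r \<noteq> K1"
      using assms(1) unfolding adj_def by (metis append_Nil letter3.distinct(1) list.collapse)
    then show thesis using that[of "[K1]" r] r by simp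
  next
    case False
    then show thesis using that[of "[]" x] by simp
  qed
  \<comment> \<open>A final 0 is always cut off, even if it is the whole image of 1, since only the
    continuation decides. The rest may end in 0 only if a cut 0 follows, as \<open>settled\<close>
    demands.\<close>
  obtain m p where m: "r = m @ p" "p = [] \<and> (m = [] \<or> last m \<noteq> K0) \<or> p = [K0]"
  proof (cases "r \<noteq> [] \<and> last r = K0")
    case True
    then show thesis using that[of "butlast r" "[K0]"] by (metis append_butlast_last_id)
  next
    case False
    then show thesis using that[of r "[]"] by auto
  qed
  show ?thesis
  proof (cases "m = []")
    case True
    then have "x = [K0] \<or> x = [K1] \<or> x = [K1, K0]" using s m assms(2) by auto
    \<comment> \<open>No block is left, so any non-empty value can stand for the preimage.\<close>
    then show ?thesis by (intro exI[of _ "[K0]"]) auto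
  next
    case False
    have "adj m" using assms(1) s m adj_append by metis
    moreover have "hd m \<noteq> K1" using False s m by auto
    ultimately obtain y where y: "m = morph theta y" using theta_preimage by blast
    then have yn: "y \<noteq> []" using False by auto
    then have ly: "p = [] \<Longrightarrow> last y \<noteq> K1" using m(2) False last_morph_theta y by blast
    show ?thesis
    proof (intro exI[of _ y] conjI allI impI yn)
      fix h k assume k: "k v = y"
      let ?q = "map Lt s @ [Pv v] @ map Lt p"
      have "?q \<in> set (choices True v)" "val h k ?q = x" "settled k ?q"
        using s m y k ly by auto
      then show "\<exists>q\<in>set (choices True v). val h k q = x \<and> settled k q" by blast
    qed
  qed
qed

section \<open>Soundness of the checker\<close>

definition holds ::
    "tok list list \<Rightarrow> (var \<Rightarrow> letter3 list) \<Rightarrow> letter3 word \<Rightarrow> nat list \<Rightarrow> bool" where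
  "holds N h w es \<longleftrightarrow> w \<in> zwords \<and> (\<forall>v. h v \<noteq> []) \<and> (\<forall>g\<in>set N. g \<noteq> [] \<and> (\<forall>v. Pv v \<notin> set g)) \<and>
    list_all2 (\<lambda>g e. ends w e (val h h g)) N es"

lemma val_no_Pv: "(\<And>v. Pv v \<notin> set g) \<Longrightarrow> val h k g = val h h g"
proof (induction g)
  case (Cons t g)
  then show ?case by (cases t) auto
qed simp

lemma val_eq_Nil:
  assumes "\<And>v. h v \<noteq> []" "g \<noteq> []" "\<And>v. Pv v \<notin> set g"
  shows "val h k g \<noteq> []"
proof (cases g)
  case (Cons t r)
  then show ?thesis using assms by (cases t) auto
qed (use assms in simp)

lemma sum_list_decrease:
  assumes "list_all2 (\<lambda>e' e. e' \<le> e \<and> (4 \<le> e \<longrightarrow> e' < e)) es' es"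
  shows "sum_list es' \<le> sum_list es \<and> ((\<exists>e\<in>set es. 4 \<le> e) \<longrightarrow> sum_list es' < sum_list (es :: nat list))"
  using assms by (induction rule: list_all2_induct) fastforce+

lemma holds_expand:
  assumes "holds N h w es"
  obtains M k u es' where "M \<in> set (expand [A, B, C, D] N)" "holds M k u es'"
    "sum_list es' \<le> sum_list es" "\<exists>e\<in>set es. 4 \<le> e \<Longrightarrow> sum_list es' < sum_list es"
proof -
  have w: "w \<in> zwords" and h: "\<And>v. h v \<noteq> []"
    and N: "\<And>g. g \<in> set N \<Longrightarrow> g \<noteq> [] \<and> (\<forall>v. Pv v \<notin> set g)"
    and es: "list_all2 (\<lambda>g e. ends w e (val h h g)) N es"
    using assms by (auto simp: holds_def)
  obtain u where u: "u \<in> zwords" "is_morph_image theta u w" "u 0 = K2 \<or> u 2 = K2"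
    using zwords_cover[OF w] .
  have fac: "\<exists>e. ends w e (val h h g)" if gN: "g \<in> set N" for g
  proof -
    obtain i where i: "i < length N" "N ! i = g" using gN by (auto simp: in_set_conv_nth)
    then show ?thesis using list_all2_nthD[OF es i(1)] by auto
  qed
  have adjh: "adj (h v)" if v: "Vr v \<in> set (concat N)" for v
  proof -
    obtain g where g: "g \<in> set N" "Vr v \<in> set g" using v by auto
    obtain a b where ab: "g = a @ Vr v # b" using g(2) by (meson split_list)
    obtain e where "ends w e (val h h g)" using fac[OF g(1)] by blast
    then have "adj (val h h g)" unfolding adj_def using adjacent_factor[OF w] by blast
    then show ?thesis using ab adj_append[of "val h h a" "h v @ val h h b"]
      adj_append[of "h v" "val h h b"] by simp
  qed
  define P where "P v y \<longleftrightarrow> y \<noteq> [] \<and> (Vr v \<in> set (concat N) \<longrightarrow>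
    (\<forall>h' k. k v = y \<longrightarrow> (\<exists>q\<in>set (choices True v). val h' k q = h v \<and> settled k q)))" for v y
  have "\<exists>y. P v y" for v
  proof (cases "Vr v \<in> set (concat N)")
    case True
    then show ?thesis using choice_exists[OF adjh[OF True] h, of v] unfolding P_def by blast
  next
    case False
    then show ?thesis unfolding P_def by (intro exI[of _ "[K0]"]) simp
  qed
  then obtain k where k: "\<And>v. P v (k v)" by metis
  have kne: "\<And>v. k v \<noteq> []" using k unfolding P_def by blast
  define Q where "Q g e x' e' \<longleftrightarrow> ends u e' x' \<and> covers h k g x' \<and> e' \<le> e \<and> (4 \<le> e \<longrightarrow> e' < e)"
    for g e x' and e' :: nat
  have cov: "\<exists>x' e'. Q g e x' e'" if gN: "g \<in> set N" and en: "ends w e (val h h g)" for g e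
  proof -
    have e: "val h k g = val h h g" using val_no_Pv N[OF gN] by blast
    have ne: "val h h g \<noteq> []" using val_eq_Nil[of h g h] h N[OF gN] by blast
    show ?thesis
      by (rule cover[OF u(2,3) ne en], unfold Q_def covers_def e) blast
  qed
  have "\<exists>xs es'. list_all2 (\<lambda>x e'. ends u e' x) xs es' \<and> list_all2 (covers h k) N xs \<and>
    list_all2 (\<lambda>e' e. e' \<le> e \<and> (4 \<le> e \<longrightarrow> e' < e)) es' es"
    using es cov
  proof (induction N es rule: list_all2_induct)
    case (Cons g N e es)
    have "\<exists>x' e'. Q g e x' e'" by (rule Cons.prems) (use Cons.hyps in auto)
    then obtain x' e' where q: "Q g e x' e'" by blast
    obtain xs es' where "list_all2 (\<lambda>x e'. ends u e' x) xs es'" "list_all2 (covers h k) N xs"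
      "list_all2 (\<lambda>e' e. e' \<le> e \<and> (4 \<le> e \<longrightarrow> e' < e)) es' es"
      using Cons by auto
    then show ?case using q by (intro exI[of _ "x' # xs"] exI[of _ "e' # es'"]) (auto simp: Q_def)
  qed auto
  then obtain xs es' where xs: "list_all2 (\<lambda>x e'. ends u e' x) xs es'" "list_all2 (covers h k) N xs"
    and es': "list_all2 (\<lambda>e' e. e' \<le> e \<and> (4 \<le> e \<longrightarrow> e' < e)) es' es" by blast
  have gx: "good x" if x: "x \<in> set xs" for x
  proof -
    obtain i where i: "i < length xs" "xs ! i = x" using x by (auto simp: in_set_conv_nth)
    then have "ends u (es' ! i) x" using list_all2_nthD[OF xs(1) i(1)] by simp
    then show ?thesis using good_factor[OF u(1)] by blast
  qed
  have "\<exists>M\<in>set (expand [A, B, C, D] N). list_all2 (\<lambda>g x. x = val k k g \<and> (\<forall>v. Pv v \<notin> set g)) M xs"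
  proof (rule expand_sound[where h=h])
    show "\<forall>g\<in>set N. settled k g \<and> good (val h k g) \<and> g \<noteq> []"
    proof
      fix g assume g: "g \<in> set N"
      obtain e where "ends w e (val h h g)" using fac[OF g] by blast
      then have "good (val h h g)" using good_factor[OF w] by blast
      moreover have "val h k g = val h h g" using val_no_Pv N[OF g] by blast
      ultimately show "settled k g \<and> good (val h k g) \<and> g \<noteq> []"
        using N[OF g] settled_const by auto
    qed
    show "\<forall>v\<in>set [A, B, C, D]. Vr v \<in> set (concat N) \<longrightarrow>
      (\<exists>q\<in>set (choices True v). val h k q = h v \<and> settled k q)"
      using k unfolding P_def by blast
    have "v \<in> set [A, B, C, D]" for v by (cases v) auto
    then show "\<forall>v. Vr v \<in> set (concat N) \<longrightarrow> v \<in> set [A, B, C, D]" by blast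
  qed (use kne xs(2) gx in auto)
  then obtain M where M: "M \<in> set (expand [A, B, C, D] N)"
    "list_all2 (\<lambda>g x. x = val k k g \<and> (\<forall>v. Pv v \<notin> set g)) M xs" by blast
  have "holds M k u es'"
    unfolding holds_def
  proof (intro conjI ballI allI u(1) kne)
    have len: "length M = length xs" "length xs = length es'"
      using M(2) xs(1) by (auto dest: list_all2_lengthD)
    show "list_all2 (\<lambda>g e. ends u e (val k k g)) M es'"
    proof (rule list_all2_all_nthI)
      fix i assume i: "i < length M"
      show "ends u (es' ! i) (val k k (M ! i))"
        using list_all2_nthD[OF M(2) i] list_all2_nthD[OF xs(1), of i] i len by simp
    qed (use len in simp)
    fix g assume g: "g \<in> set M"
    then obtain i where i: "i < length M" "M ! i = g" by (auto simp: in_set_conv_nth)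
    have gi: "xs ! i = val k k g \<and> (\<forall>v. Pv v \<notin> set g)"
      using list_all2_nthD[OF M(2) i(1)] i(2) by simp
    then show "Pv v \<notin> set g" for v by blast
    have "covers h k (N ! i) (xs ! i)" "N ! i \<in> set N"
      using xs(2) i(1) len by (auto simp: list_all2_conv_all_nth)
    moreover have "val h k (N ! i) \<noteq> []" using val_eq_Nil[of h "N ! i" k] h N[OF calculation(2)] by blast
    ultimately have "xs ! i \<noteq> []" by (auto simp: covers_def)
    then show "g \<noteq> []" using gi by auto
  qed
  moreover have "sum_list es' \<le> sum_list es" "\<exists>e\<in>set es. 4 \<le> e \<Longrightarrow> sum_list es' < sum_list es"
    using sum_list_decrease[OF es'] by blast+
  ultimately show thesis using that M(1) by blast
qed

section \<open>Partial substitutions and the soundness of matching\<close>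

definition inst :: "sg \<Rightarrow> tok list \<Rightarrow> tok list" where
  "inst s g = concat (map (\<lambda>t. case t of Vr v \<Rightarrow> look v s | _ \<Rightarrow> [t]) g)"

lemma inst_simps [simp]:
  "inst s [] = []" "inst s (Lt c # g) = Lt c # inst s g" "inst s (Vr v # g) = look v s @ inst s g"
  by (simp_all add: inst_def)

definition ext :: "sg \<Rightarrow> sg \<Rightarrow> bool" where
  "ext s s' \<longleftrightarrow> (\<forall>v. look v s \<noteq> [] \<longrightarrow> look v s' = look v s)"

fun bound :: "sg \<Rightarrow> tok list \<Rightarrow> bool" where
  "bound s [] = True"
| "bound s (Lt c # g) = bound s g"
| "bound s (Vr v # g) = (look v s \<noteq> [] \<and> bound s g)"
| "bound s (Pv v # g) = False"

lemma look_upd: "look u (upd v x s) = (if u = v then x else look u s)"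
  by (cases s; cases u; cases v) auto

lemma ext_refl [simp]: "ext s s"
  by (simp add: ext_def)

lemma ext_trans: "ext s t \<Longrightarrow> ext t r \<Longrightarrow> ext s r"
  unfolding ext_def by metis

lemma ext_upd: "look v s = [] \<Longrightarrow> ext s (upd v x s)"
  unfolding ext_def by (auto simp: look_upd)

lemma ext_bound:
  assumes "ext s t" "bound s g"
  shows "bound t g \<and> inst t g = inst s g"
  using assms(2)
proof (induction g)
  case (Cons c g)
  then show ?case using assms(1) by (cases c) (auto simp: ext_def)
qed simp

lemma strip_Some: "strip ys ts = Some r \<Longrightarrow> ts = ys @ r"
proof (induction ys arbitrary: ts)
  case (Cons y ys)
  then show ?case by (cases ts; cases "y = hd ts") auto
qed simp

lemma set_cons_fst: "set (cons_fst t xs) = (\<lambda>(a, b). (t # a, b)) ` set xs"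
  by (induction t xs rule: cons_fst.induct) auto

lemma splits_append: "(a, b) \<in> set (splits n ts) \<Longrightarrow> ts = a @ b \<and> a \<noteq> []"
  by (induction n ts arbitrary: a b rule: splits.induct) (auto simp: set_cons_fst)

lemma mt_split_iff: "t \<in> set (mt_split xs v p s) \<longleftrightarrow> (\<exists>(a, r)\<in>set xs. t \<in> set (mt p r (upd v a s)))"
proof (induction xs)
  case (Cons x xs)
  then show ?case by (cases x) auto
qed simp

lemma mt_sound:
  "t \<in> set (mt p ts s) \<Longrightarrow> ext s t \<and> bound t p \<and> (\<exists>r. ts = inst t p @ r)"
proof (induction p arbitrary: ts s)
  case (Cons c p)
  show ?case
  proof (cases c)
    case (Lt d)
    then show ?thesis using Cons by (cases ts; cases "hd ts = Lt d") auto
  next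
    case (Pv v)
    then show ?thesis using Cons.prems by simp
  next
    case (Vr v)
    show ?thesis
    proof (cases "look v s")
      case Nil
      then obtain a r where ar: "(a, r) \<in> set (splits (Suc (Suc (Suc (Suc 0)))) ts)"
        "t \<in> set (mt p r (upd v a s))"
        using Cons.prems Vr by (auto simp only: mt.simps mt_var.simps mt_split_iff)
      have ts: "ts = a @ r" "a \<noteq> []" using splits_append[OF ar(1)] by auto
      have IH: "ext (upd v a s) t \<and> bound t p \<and> (\<exists>r'. r = inst t p @ r')" by (rule Cons.IH[OF ar(2)])
      then have "look v t = a" using ts(2) unfolding ext_def by (metis look_upd)
      moreover have "ext s t" using IH ext_upd[OF Nil] ext_trans by blast
      ultimately show ?thesis using IH ts Vr by auto
    next
      case (Cons y ys)
      then obtain r where r: "strip (y # ys) ts = Some r" "t \<in> set (mt p r s)"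
        using Cons.prems Vr by (cases "strip (y # ys) ts") auto
      have ts: "ts = (y # ys) @ r" by (rule strip_Some[OF r(1)])
      have IH: "ext s t \<and> bound t p \<and> (\<exists>r'. r = inst t p @ r')" by (rule Cons.IH[OF r(2)])
      then have "look v t = y # ys" using Cons unfolding ext_def by (metis list.distinct(1))
      then show ?thesis using IH ts Vr by auto
    qed
  qed
qed simp

definition part :: "tok list \<Rightarrow> tok list \<Rightarrow> bool" where
  "part p g \<longleftrightarrow> (\<exists>a b. g = a @ p @ b)"

lemma mt_suf_sound: "t \<in> set (mt_suf p g s) \<Longrightarrow> ext s t \<and> bound t p \<and> part (inst t p) g"
proof (induction g)
  case (Cons c g)
  show ?case
  proof (cases "t \<in> set (mt p (c # g) s)")
    case True
    then show ?thesis using mt_sound[OF True] unfolding part_def by (metis append_Nil)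
  next
    case False
    then have "ext s t \<and> bound t p \<and> part (inst t p) g" using Cons by simp
    then show ?thesis unfolding part_def by (metis append_Cons)
  qed
qed simp

lemma mt_any_sound: "t \<in> set (mt_any p N s) \<Longrightarrow> ext s t \<and> bound t p \<and> (\<exists>g\<in>set N. part (inst t p) g)"
  by (induction N) (use mt_suf_sound in fastforce)+

lemma mt_all_sound:
  "t \<in> set (mt_all p N ss) \<Longrightarrow> \<exists>s\<in>set ss. ext s t \<and> bound t p \<and> (\<exists>g\<in>set N. part (inst t p) g)"
  by (induction ss) (use mt_any_sound in fastforce)+

lemma match_any_sound:
  "match_any P N ss \<Longrightarrow> \<exists>s\<in>set ss. \<exists>t. ext s t \<and> (\<forall>p\<in>set P. bound t p \<and> (\<exists>g\<in>set N. part (inst t p) g))"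
proof (induction P N ss rule: match_any.induct)
  case (2 N s ss)
  then show ?case by (intro bexI[of _ s] exI[of _ s]) auto
next
  case (3 p P N s ss)
  then obtain t r where t: "t \<in> set (mt_all p N (s # ss))" "ext t r"
    "\<forall>p\<in>set P. bound r p \<and> (\<exists>g\<in>set N. part (inst r p) g)" by auto
  from mt_all_sound[OF t(1)] obtain s' where s': "s' \<in> set (s # ss)" "ext s' t" "bound t p"
    "\<exists>g\<in>set N. part (inst t p) g" by blast
  have "bound r p \<and> inst r p = inst t p" by (rule ext_bound[OF t(2) s'(3)])
  then show ?case using s' t ext_trans[OF s'(2) t(2)] by (intro bexI[OF _ s'(1)] exI[of _ r]) auto
qed simp

lemma match_each_sound:
  "match_each P N ss \<Longrightarrow> \<exists>s\<in>set ss. \<exists>t. ext s t \<and> length P \<le> length N \<and>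
    (\<forall>i<length P. bound t (P ! i) \<and> part (inst t (P ! i)) (N ! i))"
proof (induction P N ss rule: match_each.induct)
  case (2 N s ss)
  then show ?case by (intro bexI[of _ s] exI[of _ s]) auto
next
  case (4 p P g N s ss)
  then obtain t r where t: "t \<in> set (mt_all p [g] (s # ss))" "ext t r" "length P \<le> length N"
    "\<forall>i<length P. bound r (P ! i) \<and> part (inst r (P ! i)) (N ! i)" by auto
  from mt_all_sound[OF t(1)] obtain s' where s': "s' \<in> set (s # ss)" "ext s' t" "bound t p"
    "part (inst t p) g" by auto
  have "bound r p \<and> inst r p = inst t p" by (rule ext_bound[OF t(2) s'(3)])
  then have "\<forall>i<length (p # P). bound r ((p # P) ! i) \<and> part (inst r ((p # P) ! i)) ((g # N) ! i)"
    using s' t by (auto simp: nth_Cons split: nat.split)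
  then show ?case using t ext_trans[OF s'(2) t(2)] by (intro bexI[OF _ s'(1)] exI[of _ r]) auto
qed simp_all

section \<open>Impossible patterns and infinite descent\<close>

definition impossible :: "tok list list \<Rightarrow> bool" where
  "impossible P \<longleftrightarrow> \<not> (\<exists>h w es. holds P h w es)"

text \<open>The composition of \<open>h\<close> with the substitution found by matching. Unassigned
  variables get a default letter, which keeps the morphism non-erasing.\<close>

definition pull :: "(var \<Rightarrow> letter3 list) \<Rightarrow> sg \<Rightarrow> var \<Rightarrow> letter3 list" where
  "pull h s v = (if look v s = [] then [K0] else val h h (look v s))"

lemma val_pull: "bound s p \<Longrightarrow> val (pull h s) k p = val h h (inst s p)"
  by (induction s p rule: bound.induct) (auto simp: pull_def)

lemma bound_no_Pv: "bound s p \<Longrightarrow> Pv v \<notin> set p"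
  by (induction s p rule: bound.induct) auto

lemma pull_ne:
  assumes "\<And>v. h v \<noteq> []"
  shows "pull h s v \<noteq> []"
proof (cases "look v s")
  case (Cons t r)
  then show ?thesis using assms by (cases t) (auto simp: pull_def)
qed (simp add: pull_def)

lemma part_ends:
  assumes "part q g" "ends w e (val h h g)"
  shows "\<exists>e'\<le>e. ends w e' (val h h q)"
proof -
  obtain a b where "g = a @ q @ b" using assms(1) part_def by blast
  then show ?thesis using assms(2) ends_factor[of w e "val h h a" "val h h q" "val h h b"]
    by (intro exI[of _ "e - length (val h h b)"]) simp
qed

lemma holds_match_any:
  assumes "holds N h w es" "match_any P N [s]" "[] \<notin> set P"
  shows "\<not> impossible P"
proof -
  obtain t where t: "\<forall>p\<in>set P. bound t p \<and> (\<exists>g\<in>set N. part (inst t p) g)"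
    using match_any_sound[OF assms(2)] by auto
  have h: "\<And>v. h v \<noteq> []" and w: "w \<in> zwords" using assms(1) by (auto simp: holds_def)
  have "\<exists>e. ends w e (val (pull h t) (pull h t) p)" if p: "p \<in> set P" for p
  proof -
    obtain g where g: "g \<in> set N" "part (inst t p) g" "bound t p" using t p by blast
    obtain i where i: "i < length N" "N ! i = g" using g(1) by (auto simp: in_set_conv_nth)
    then have "ends w (es ! i) (val h h g)"
      using assms(1) by (auto simp: holds_def list_all2_conv_all_nth)
    then show ?thesis using part_ends[OF g(2)] val_pull[OF g(3)] by metis
  qed
  then obtain f where f: "\<And>p. p \<in> set P \<Longrightarrow> ends w (f p) (val (pull h t) (pull h t) p)" by metis
  have "holds P (pull h t) w (map f P)"
    unfolding holds_def using f w t pull_ne[OF h] bound_no_Pv assms(3)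
    by (auto simp: list_all2_conv_all_nth)
  then show ?thesis unfolding impossible_def by blast
qed

lemma holds_match_each:
  assumes "holds N h w es" "match_each P N [s]" "[] \<notin> set P"
  shows "\<exists>h' es'. holds P h' w es' \<and> sum_list es' \<le> sum_list es"
proof -
  obtain t where t: "length P \<le> length N"
    "\<forall>i<length P. bound t (P ! i) \<and> part (inst t (P ! i)) (N ! i)"
    using match_each_sound[OF assms(2)] by auto
  have h: "\<And>v. h v \<noteq> []" and w: "w \<in> zwords" and l: "length es = length N"
    using assms(1) by (auto simp: holds_def list_all2_lengthD)
  have "\<exists>e'\<le>es ! i. ends w e' (val (pull h t) (pull h t) (P ! i))" if i: "i < length P" for i
  proof -
    have "ends w (es ! i) (val h h (N ! i))"
      using assms(1) i t(1) by (auto simp: holds_def list_all2_conv_all_nth)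
    moreover have "bound t (P ! i)" "part (inst t (P ! i)) (N ! i)" using t(2) i by auto
    ultimately show ?thesis using part_ends val_pull by metis
  qed
  then obtain f where f: "\<And>i. i < length P \<Longrightarrow> f i \<le> es ! i \<and> ends w (f i) (val (pull h t) (pull h t) (P ! i))"
    by metis
  let ?es = "map f [0..<length P]"
  have "Pv v \<notin> set p" if "p \<in> set P" for p v
    using that t(2) bound_no_Pv by (metis in_set_conv_nth)
  then have "holds P (pull h t) w ?es"
    unfolding holds_def using f w pull_ne[OF h] assms(3) by (auto simp: list_all2_conv_all_nth)
  moreover have "sum_list ?es \<le> sum_list es"
  proof -
    have "sum_list ?es \<le> sum_list (take (length P) es)"
      using f l t(1) by (intro sum_list_mono2) auto
    also have "\<dots> \<le> sum_list es" by (metis append_take_drop_id le_add1 sum_list_append)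
    finally show ?thesis .
  qed
  ultimately show ?thesis by blast
qed

lemma known_sound: "known Ks N \<Longrightarrow> \<exists>P\<in>set Ks. match_any P N [Sg [] [] [] []]"
proof (induction Ks)
  case (Cons P Ks)
  then show ?case by (cases "match_any P N [Sg [] [] [] []]") auto
qed simp

lemma hyp_sound: "hyp Hs N \<Longrightarrow> \<exists>P\<in>set Hs. match_each P N [Sg [] [] [] []]"
proof (induction Hs)
  case (Cons P Hs)
  then show ?case by (cases "match_each P N [Sg [] [] [] []]") auto
qed simp

lemma or_else_iff: "or_else b Hs N \<longleftrightarrow> b \<or> hyp Hs N"
  by (cases b) auto

lemma holds_rev: "holds N h w es \<Longrightarrow> holds (rev N) h w (rev es)"
  by (auto simp: holds_def)

text \<open>The bound m encodes minimality: no pattern of \<open>Hs\<close> occurs with a smaller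
  sum of ends. Expansion and matching never increase this sum, so the bound passes back to N.
  Strictness is supplied separately, in \<open>impossible_if_closed\<close>.\<close>

lemma refuted_sound:
  assumes Ks: "\<And>P. P \<in> set Ks \<Longrightarrow> impossible P \<and> [] \<notin> set P"
    and Hs: "\<And>P h w es. P \<in> set Hs \<Longrightarrow> holds P h w es \<Longrightarrow> m \<le> sum_list es"
    and ne: "\<And>P. P \<in> set Hs \<Longrightarrow> [] \<notin> set P"
  shows "refuted n Ks Hs N \<Longrightarrow> holds N h w es \<Longrightarrow> m \<le> sum_list es"
proof (induction n arbitrary: N h w es rule: less_induct)
  case (less n)
  have nk: "\<not> known Ks N"
    using known_sound holds_match_any[OF less.prems(2)] Ks by blast
  have step: "m \<le> sum_list es'" if hold: "holds N' h w es'" and hyp: "hyp Hs N'" for N' es'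
  proof -
    obtain P where P: "P \<in> set Hs" "match_each P N' [Sg [] [] [] []]" using hyp_sound[OF hyp] by blast
    then obtain h' es'' where "holds P h' w es''" "sum_list es'' \<le> sum_list es'"
      using holds_match_each[OF hold P(2) ne[OF P(1)]] by blast
    then show ?thesis using Hs[OF P(1)] le_trans by blast
  qed
  show ?case
  proof (cases "hyp Hs N \<or> hyp Hs (rev N)")
    case True
    then show ?thesis using step[OF less.prems(2)] step[OF holds_rev[OF less.prems(2)]] by auto
  next
    case False
    then have "\<not> or_else (or_else (known Ks N) Hs N) Hs (rev N)" using nk by (simp add: or_else_iff)
    then obtain n' where n': "n = Suc n'" "list_all (refuted n' Ks Hs) (expand [A, B, C, D] N)"
      using less.prems(1) by (cases n) (auto simp del: expand.simps)
    obtain M k u es' where M: "M \<in> set (expand [A, B, C, D] N)" "holds M k u es'"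
      "sum_list es' \<le> sum_list es" using holds_expand[OF less.prems(2)] by metis
    have "refuted n' Ks Hs M" using n'(2) M(1) by (simp add: list_all_iff del: refuted.simps expand.simps)
    then have "m \<le> sum_list es'" using less.IH[of n' M k u es'] M(2) n'(1) by blast
    then show ?thesis using M(3) by simp
  qed
qed

text \<open>Without induction hypotheses the bound in \<open>refuted_sound\<close> is arbitrary; one
  more than the actual sum is absurd.\<close>

lemma impossible_if_refuted:
  assumes "\<And>P. P \<in> set Ks \<Longrightarrow> impossible P \<and> [] \<notin> set P"
    and "list_all (refuted n Ks []) (expand [A, B, C, D] N)"
  shows "impossible N"
  unfolding impossible_def
proof
  assume "\<exists>h w es. holds N h w es"
  then obtain h w es M k u es' where "M \<in> set (expand [A, B, C, D] N)" "holds M k u es'"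
    using holds_expand by metis
  moreover have "refuted n Ks [] M"
    using assms(2) calculation(1) by (simp add: list_all_iff del: refuted.simps expand.simps)
  ultimately have "Suc (sum_list es') \<le> sum_list es'"
    using refuted_sound[of Ks "[]" "Suc (sum_list es')" n M k u es'] assms(1) by simp
  then show False by simp
qed

text \<open>The descent runs over all patterns of \<open>Hs\<close> simultaneously. A fragment of
  four tokens ends at 4 or later, so the first expansion strictly decreases the sum of ends.\<close>

lemma impossible_if_closed:
  assumes Ks: "\<And>P. P \<in> set Ks \<Longrightarrow> impossible P \<and> [] \<notin> set P"
    and Hs: "\<And>P. P \<in> set Hs \<Longrightarrow> P \<noteq> [] \<and> (\<forall>g\<in>set P. 4 \<le> length g) \<and>
      list_all (refuted n Ks Hs) (expand [A, B, C, D] P)"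
    and "P \<in> set Hs"
  shows "impossible P"
proof -
  have "\<not> holds P h w es" if "P \<in> set Hs" for P h w es
    using that
  proof (induction "sum_list es" arbitrary: P h w es rule: less_induct)
    case less
    show ?case
    proof
      assume hold: "holds P h w es"
      have val4: "length g \<le> length (val h h g)" if "\<forall>v. h v \<noteq> []" "\<forall>v. Pv v \<notin> set g" for g
        using that(2)
      proof (induction g)
        case (Cons t g)
        have "0 < length (tval h h t)" using that(1) Cons.prems by (cases t) auto
        then show ?case using Cons by (simp del: length_greater_0_conv)
      qed simp
      obtain g P' where P: "P = g # P'" using Hs[OF less.prems] by (cases P) auto
      then obtain e es0 where es: "es = e # es0" "ends w e (val h h g)"
        using hold by (auto simp: holds_def list_all2_Cons1)
      have "4 \<le> length g" using Hs[OF less.prems] P by simp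
      moreover have "length g \<le> length (val h h g)" using val4 hold P by (simp add: holds_def)
      ultimately have "4 \<le> e" using es(2) by (simp add: ends_def)
      then have e4: "\<exists>e\<in>set es. 4 \<le> e" using es by simp
      obtain M k u es' where M: "M \<in> set (expand [A, B, C, D] P)" "holds M k u es'"
        "sum_list es' < sum_list es" using holds_expand[OF hold] e4 by metis
      have "refuted n Ks Hs M"
        using Hs[OF less.prems] M(1) by (simp add: list_all_iff del: refuted.simps expand.simps)
      moreover have "[] \<notin> set P" if "P \<in> set Hs" for P using Hs[OF that] by fastforce
      moreover have "sum_list es \<le> sum_list es0" if "P \<in> set Hs" "holds P h w es0" for P h w es0
        using less.hyps[of es0 P h w] that by (meson not_le)
      ultimately have "sum_list es \<le> sum_list es'"
        using refuted_sound[of Ks Hs "sum_list es" n M k u es'] Ks M(2) by blast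
      then show False using M(3) by simp
    qed
  qed
  then show ?thesis using assms(3) unfolding impossible_def by blast
qed

section \<open>Patterns avoided by \<open>z\<^sub>3\<close>\<close>

text \<open>The patterns of the descent were found by experiment.\<close>
definition "pat_1x2 = [[Lt K1, Vr A, Lt K2], [Vr A, Lt K1]]"
definition "pat_x22 = [[Vr A, Lt K2, Lt K2], [Vr A, Lt K1]]"
definition "pat_y2x1 = [[Vr B, Lt K2, Vr A, Lt K1], [Vr A, Vr B, Lt K1]]"
definition "pat_x2y1 = [[Vr A, Lt K2, Vr B, Lt K1], [Vr A, Lt K2, Vr B, Lt K2]]"

text \<open>The last pattern is the overlap ABABA; all four serve as hypotheses in one common
  descent.\<close>

definition "overlap_pats = [[[Vr B, Lt K1, Vr B, Lt K2]], [[Vr B, Lt K2, Vr B, Lt K1]],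
  [[Vr B, Lt K1, Lt K0, Vr B, Lt K2]], [[Vr A, Vr B, Vr A, Vr B, Vr A]]]"

text \<open>Squares of two conjugate words, AB and BA, occurring in the same word.\<close>

definition "square_pat = [[Vr A, Vr B, Vr A, Vr B], [Vr B, Vr A, Vr B, Vr A]]"

definition "known_pats = [pat_1x2, pat_x22, [[Vr B, Lt K1, Vr B, Lt K2]], [[Vr B, Lt K2, Vr B, Lt K1]],
  [[Vr B, Lt K1, Lt K0, Vr B, Lt K2]], pat_y2x1, pat_x2y1, [[Vr A, Vr B, Vr A, Vr B, Vr A]], square_pat]"

definition "formula_2 = [[Vr A, Vr B, Vr C, Vr D, Vr A, Vr D, Vr C], [Vr C, Vr D, Vr A, Vr D, Vr C, Vr B, Vr A]]"
text \<open>Models parents of \<open>formula_2\<close> in which A is the single letter 0: inside a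
  fragment a following 1 turns it into 2, while at the end of the second fragment the 0 may come
  from 1.\<close>

definition "formula_2' = [[Vr B, Vr C, Vr D, Lt K2, Vr D, Vr C], [Vr C, Vr D, Lt K2, Vr D, Vr C, Vr B, Lt K1]]"
definition "formula_3 = [[Vr A, Vr B, Vr A, Vr C, Vr D, Vr B, Vr A, Vr C],
  [Vr C, Vr A, Vr B, Vr D, Vr C, Vr A, Vr B, Vr A]]"

lemmas pat_defs = pat_1x2_def pat_x22_def pat_y2x1_def pat_x2y1_def square_pat_def

definition fuel :: nat where
  "fuel = Suc (Suc (Suc (Suc (Suc (Suc (Suc (Suc (Suc 0))))))))"

lemma impossible_1x2: "impossible pat_1x2"
proof (rule impossible_if_refuted[of "[]"])
  show "list_all (refuted fuel [] []) (expand [A, B, C, D] pat_1x2)" by code_simp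
qed simp

lemma impossible_x22: "impossible pat_x22"
proof (rule impossible_if_refuted[of "[pat_1x2]"])
  show "list_all (refuted fuel [pat_1x2] []) (expand [A, B, C, D] pat_x22)" by code_simp
qed (use impossible_1x2 in \<open>simp add: pat_defs\<close>)

lemma impossible_y2x1: "impossible pat_y2x1"
proof (rule impossible_if_refuted[of "[pat_1x2, pat_x22]"])
  show "list_all (refuted fuel [pat_1x2, pat_x22] []) (expand [A, B, C, D] pat_y2x1)" by code_simp
qed (use impossible_1x2 impossible_x22 in \<open>auto simp: pat_defs\<close>)

lemma impossible_x2y1: "impossible pat_x2y1"
proof (rule impossible_if_refuted[of "[pat_1x2, pat_x22, pat_y2x1]"])
  show "list_all (refuted fuel [pat_1x2, pat_x22, pat_y2x1] []) (expand [A, B, C, D] pat_x2y1)"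
    by code_simp
qed (use impossible_1x2 impossible_x22 impossible_y2x1 in \<open>auto simp: pat_defs\<close>)

lemma impossible_overlap: "P \<in> set overlap_pats \<Longrightarrow> impossible P"
proof (rule impossible_if_closed[of "[pat_1x2, pat_x22, pat_y2x1, pat_x2y1]" overlap_pats fuel])
  fix P assume P: "P \<in> set overlap_pats"
  have 1: "list_all (\<lambda>P. list_all (refuted fuel [pat_1x2, pat_x22, pat_y2x1, pat_x2y1] overlap_pats)
      (expand [A, B, C, D] P)) overlap_pats"
    by code_simp
  have 2: "\<forall>P\<in>set overlap_pats. P \<noteq> [] \<and> (\<forall>g\<in>set P. 4 \<le> length g)"
    by (simp add: overlap_pats_def)
  show "P \<noteq> [] \<and> (\<forall>g\<in>set P. 4 \<le> length g) \<and>
      list_all (refuted fuel [pat_1x2, pat_x22, pat_y2x1, pat_x2y1] overlap_pats) (expand [A, B, C, D] P)"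
    using P 1 2 unfolding list_all_iff by blast
qed (use impossible_1x2 impossible_x22 impossible_y2x1 impossible_x2y1 in \<open>auto simp: pat_defs\<close>)

lemma impossible_square: "impossible square_pat"
proof (rule impossible_if_closed[of "[pat_1x2, pat_x22, pat_y2x1, pat_x2y1] @ overlap_pats" "[square_pat]" fuel])
  have 1: "list_all (refuted fuel ([pat_1x2, pat_x22, pat_y2x1, pat_x2y1] @ overlap_pats) [square_pat])
      (expand [A, B, C, D] square_pat)"
    by code_simp
  have 2: "square_pat \<noteq> [] \<and> (\<forall>g\<in>set square_pat. 4 \<le> length g)" by (simp add: square_pat_def)
  show "P \<noteq> [] \<and> (\<forall>g\<in>set P. 4 \<le> length g) \<and>
      list_all (refuted fuel ([pat_1x2, pat_x22, pat_y2x1, pat_x2y1] @ overlap_pats) [square_pat])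
        (expand [A, B, C, D] P)" if "P \<in> set [square_pat]" for P
  proof -
    have P: "P = square_pat" using that by simp
    show ?thesis unfolding P by (intro conjI 1 conjunct1[OF 2] conjunct2[OF 2])
  qed
  show "impossible P \<and> [] \<notin> set P" if "P \<in> set ([pat_1x2, pat_x22, pat_y2x1, pat_x2y1] @ overlap_pats)" for P
  proof -
    have "[] \<notin> set P" using that by (auto simp: pat_defs overlap_pats_def)
    then show ?thesis
      using that impossible_1x2 impossible_x22 impossible_y2x1 impossible_x2y1 impossible_overlap by auto
  qed
qed simp

lemma known_pats: "P \<in> set known_pats \<Longrightarrow> impossible P \<and> [] \<notin> set P"
proof -
  assume P: "P \<in> set known_pats"
  then have "[] \<notin> set P" by (auto simp: known_pats_def pat_defs)
  moreover have "\<forall>Q\<in>set overlap_pats. impossible Q" using impossible_overlap by blast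
  then have "impossible P"
    using P impossible_1x2 impossible_x22 impossible_y2x1 impossible_x2y1 impossible_square
    by (simp add: known_pats_def overlap_pats_def) (elim conjE disjE; simp)
  ultimately show ?thesis by blast
qed

lemma impossible_formula_3: "impossible formula_3"
proof (rule impossible_if_closed[of known_pats "[formula_3]" fuel])
  have 1: "list_all (refuted fuel known_pats [formula_3]) (expand [A, B, C, D] formula_3)"
    by code_simp
  have 2: "formula_3 \<noteq> [] \<and> (\<forall>g\<in>set formula_3. 4 \<le> length g)" by (simp add: formula_3_def)
  show "P \<noteq> [] \<and> (\<forall>g\<in>set P. 4 \<le> length g) \<and>
      list_all (refuted fuel known_pats [formula_3]) (expand [A, B, C, D] P)" if "P \<in> set [formula_3]" for P
  proof -
    have P: "P = formula_3" using that by simp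
    show ?thesis unfolding P by (intro conjI 1 conjunct1[OF 2] conjunct2[OF 2])
  qed
  show "formula_3 \<in> set [formula_3]" by simp
qed (rule known_pats)

lemma impossible_formula_2: "impossible formula_2"
proof (rule impossible_if_closed[of known_pats "[formula_2, formula_2']" fuel])
  have 1: "list_all (refuted fuel known_pats [formula_2, formula_2']) (expand [A, B, C, D] formula_2)"
    by code_simp
  have 2: "list_all (refuted fuel known_pats [formula_2, formula_2']) (expand [A, B, C, D] formula_2')"
    by code_simp
  have 3: "formula_2 \<noteq> [] \<and> (\<forall>g\<in>set formula_2. 4 \<le> length g)" by (simp add: formula_2_def)
  have 4: "formula_2' \<noteq> [] \<and> (\<forall>g\<in>set formula_2'. 4 \<le> length g)" by (simp add: formula_2'_def)
  show "P \<noteq> [] \<and> (\<forall>g\<in>set P. 4 \<le> length g) \<and>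
      list_all (refuted fuel known_pats [formula_2, formula_2']) (expand [A, B, C, D] P)"
    if "P \<in> set [formula_2, formula_2']" for P
  proof -
    have "P = formula_2 \<or> P = formula_2'" using that by simp
    then show ?thesis
    proof
      assume P: "P = formula_2"
      show ?thesis unfolding P by (intro conjI 1 conjunct1[OF 3] conjunct2[OF 3])
    next
      assume P: "P = formula_2'"
      show ?thesis unfolding P by (intro conjI 2 conjunct1[OF 4] conjunct2[OF 4])
    qed
  qed
  show "formula_2 \<in> set [formula_2, formula_2']" by simp
qed (rule known_pats)

lemma avoids_z3:
  assumes "impossible (map (map Vr) fs)" "[] \<notin> set fs"
  shows "avoids z3 (set fs)"
  unfolding avoids_def
proof
  assume "\<exists>h. occurrence h (set fs) z3"
  then obtain h where h: "\<And>v. h v \<noteq> []" "\<And>f. f \<in> set fs \<Longrightarrow> is_factor (morph h f) z3"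
    by (auto simp: occurrence_def nonerasing_def)
  have val: "val h h (map Vr f) = morph h f" for f by (induction f) auto
  have "\<exists>e. ends z3 e (morph h f)" if "f \<in> set fs" for f
    using h(2)[OF that] is_factor_iff_ends by blast
  then obtain e where e: "\<And>f. f \<in> set fs \<Longrightarrow> ends z3 (e f) (morph h f)" by metis
  have "holds (map (map Vr) fs) h z3 (map e fs)"
    unfolding holds_def using h(1) e assms(2)
    by (auto simp: zwords_def list_all2_conv_all_nth val)
  then show False using assms(1) unfolding impossible_def by blast
qed

theorem theorem18:
  shows "avoids b4 {[A,D,B,D,C,D,A,D], [D,A,D,C,D,B,D,A]} \<and>
    avoids z3 {[A,B,C,D,A,D,C], [C,D,A,D,C,B,A]} \<and>
    avoids z3 {[A,B,A,C,D,B,A,C], [C,A,B,D,C,A,B,A]} \<and>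
    avoids b4 {[A,B,A,C,D,B,A,C], [C,A,B,D,C,A,B,A]}"
proof (intro conjI)
  show "avoids z3 {[A,B,C,D,A,D,C], [C,D,A,D,C,B,A]}"
    using avoids_z3[of "[[A,B,C,D,A,D,C], [C,D,A,D,C,B,A]]"] impossible_formula_2
    by (simp add: formula_2_def)
  show "avoids z3 {[A,B,A,C,D,B,A,C], [C,A,B,D,C,A,B,A]}"
    using avoids_z3[of "[[A,B,A,C,D,B,A,C], [C,A,B,D,C,A,B,A]]"] impossible_formula_3
    by (simp add: formula_3_def)
qed (rule b4_avoids_1 b4_avoids_2)+

end
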